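(* Let $q=q(n)$ satisfy $qn\gg\log n$, let $(G_n)_{n\in\mathbb{N}}$ be a sequence of weakly $q$-pseudorandom $n$-vertex graphs with $V(G_n)=[n]$, and let $H=K_2\times G_n$. Let "Left meets Right" denote the event that $\mathbf{H}_\mu$ contains a connected component containing strictly more than half of the vertices of $\{1\}\times[n]$ and strictly more than half of the vertices of $\{2\}\times[n]$. Then: (i) If $p>4-2\sqrt{3}$ is fixed, then for every $\mu\in\mathcal{M}_{1,p}(H)$, $\mathbb{P}[\text{Left meets Right}]=1-o(1)$. (ii) If $\frac12<p\leq4-2\sqrt3$ is fixed, then there exists $\mu\in\mathcal{M}_{1,\geq p}(H)$ such that $\mathbb{P}[\text{Left meets Right}]=o(1)$.
   Context: A sequence $(G_n)$ of $n$-vertex graphs is weakly $q$-pseudorandom if $\max\{|e(G_n[U])-q|U|^2/2|:\ U\subseteq V(G_n)\}=o(qn^2)$. $K_2\times G_n$ is the Cartesian product: vertex set $[2]\times[n]$, with $(i,u)\sim(i,v)$ whenever $uv\in E(G_n)$, and $(1,v)\sim(2,v)$ for every $v$. A random graph model on $H$ is a probability measure $\mu$ on subsets of $E(H)$, and $\mathbf{H}_\mu$ is the random spanning subgraph with edge set distributed according to $\mu$. $\mu$ is $1$-independent if for all sets $A,B\subseteq E(H)$ whose edges span disjoint vertex sets, $E(\mathbf{H}_\mu)\cap A$ and $E(\mathbf{H}_\mu)\cap B$ are independent. $\mathcal{M}_{1,p}(H)$ (resp. $\mathcal{M}_{1,\geq p}(H)$) is the set of $1$-independent measures on $H$ in which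 each edge is present with probability exactly (resp. at least) $p$. Asymptotics are as $n\to\infty$. *)

theory Defs
  imports "HOL-Probability.Probability" "HOL-Library.Landau_Symbols"
begin

definition graph_on :: "nat \<Rightarrow> nat set set \<Rightarrow> bool" where
  "graph_on n E \<longleftrightarrow> (\<forall>e\<in>E. e \<subseteq> {1..n} \<and> card e = 2)"

definition edges_in :: "nat set set \<Rightarrow> nat set \<Rightarrow> nat" where
  "edges_in E U = card {e\<in>E. e \<subseteq> U}"

definition weakly_pseudorandom :: "(nat \<Rightarrow> real) \<Rightarrow> (nat \<Rightarrow> nat set set) \<Rightarrow> bool" where
  "weakly_pseudorandom q G \<longleftrightarrow>
     (\<lambda>n. Max {\<bar>real (edges_in (G n) U) - q n * real (card U) ^ 2 / 2\<bar> | U. U \<subseteq> {1..n}})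
       \<in> o[at_top](\<lambda>n. q n * real n ^ 2)"

definition prod_K2 :: "nat \<Rightarrow> nat set set \<Rightarrow> (nat \<times> nat) set set" where
  "prod_K2 n E =
     {{(i,u),(i,v)} | i u v. i \<in> {1,2} \<and> {u,v} \<in> E} \<union> {{(1,v),(2,v)} | v. v \<in> {1..n}}"

definition one_independent :: "'v set set \<Rightarrow> 'v set set pmf \<Rightarrow> bool" where
  "one_independent H \<mu> \<longleftrightarrow>
     (\<forall>A B. A \<subseteq> H \<and> B \<subseteq> H \<and> \<Union>A \<inter> \<Union>B = {} \<longrightarrow>
        (\<forall>a b. measure_pmf.prob \<mu> {S. S \<inter> A = a \<and> S \<inter> B = b}
               = measure_pmf.prob \<mu> {S. S \<inter> A = a} * measure_pmf.prob \<mu> {S. S \<inter> B = b}))"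

definition M1p :: "'v set set \<Rightarrow> real \<Rightarrow> 'v set set pmf set" where
  "M1p H p = {\<mu>. set_pmf \<mu> \<subseteq> Pow H \<and> one_independent H \<mu> \<and>
                  (\<forall>e\<in>H. measure_pmf.prob \<mu> {S. e \<in> S} = p)}"

definition M1gep :: "'v set set \<Rightarrow> real \<Rightarrow> 'v set set pmf set" where
  "M1gep H p = {\<mu>. set_pmf \<mu> \<subseteq> Pow H \<and> one_independent H \<mu> \<and>
                  (\<forall>e\<in>H. measure_pmf.prob \<mu> {S. e \<in> S} \<ge> p)}"

definition component :: "'v set set \<Rightarrow> 'v \<Rightarrow> 'v set" where
  "component S v = {w. (v, w) \<in> {(x,y). {x,y} \<in> S}\<^sup>*}"

definition left_meets_right :: "nat \<Rightarrow> (nat \<times> nat) set set \<Rightarrow> bool" where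
  "left_meets_right n S \<longleftrightarrow>
     (\<exists>v\<in>{1,2} \<times> {1..n}.
        2 * card (component S v \<inter> ({1} \<times> {1..n})) > n \<and>
        2 * card (component S v \<inter> ({2} \<times> {1..n})) > n)"

end

theory Submission
  imports Defs
begin

text \<open>
  Write \<open>s = sqrt 3 - 1\<close>, so that the threshold is \<open>s\<^sup>2 = 2 - 2 * s\<close>.

  (i) Let \<open>U\<close> be a set of vertices that is independent of the left copy. By Chebyshev's inequality
  the left copy keeps a proportion of about \<open>p\<close> of the edges inside \<open>U\<close>, and all of these lie inside
  components, so by pseudorandomness the large left components \<open>C\<close> satisfy
  \<open>(\<Sum>C. \<bar>C \<inter> U\<bar>\<^sup>2) > s\<^sup>2 * \<bar>U\<bar>\<^sup>2\<close>. Hence one component dominates \<open>U\<close>, and if the large components are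
  split into two classes with unions \<open>X1\<close>, \<open>X2\<close>, the dominating one being in the first, then
  convexity gives the linear inequality \<open>\<bar>X1 \<inter> U\<bar> + (1 - s) * \<bar>X2 \<inter> U\<bar> \<ge> s * \<bar>U\<bar>\<close>.
  If Left does not meet Right, let \<open>K\<close> be the component of the left giant, let \<open>X1\<close>, \<open>X2\<close> be the unions
  of the large left components inside and outside \<open>K\<close>, and \<open>Y1\<close>, \<open>Y2\<close> the unions of the large right
  components outside and inside \<open>K\<close>. The linear inequality for the complement of \<open>Y2\<close>, and the
  symmetric one for the complement of \<open>X2\<close>, add up to
  \<open>\<bar>X1 \<inter> Y1\<bar> + \<bar>X2 \<inter> Y2\<bar> \<ge> (2 * s - 1) * n = (1 - s\<^sup>2) * n\<close>. No vertical edge is present at such vertices,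
  whereas only about \<open>(1 - p) * n\<close> vertical edges are missing. Since \<open>Y2\<close> is a union of large right
  components, it is one of boundedly many sets determined by the right copy, which is
  independent of the left one, so a union bound suffices.

  (ii) Colour each left vertex red with probability \<open>(1 + sqrt (2 * p - 1)) / 2\<close> and blue otherwise, and
  switch each right vertex on with probability \<open>sqrt p\<close>. Keep the monochromatic left edges, the right
  edges between two vertices that are on, and every vertical edge except those from red to on.
\<close>

section \<open>Components and edge counts\<close>

lemma component_refl [simp]: "v \<in> component S v"
  by (simp add: component_def)

lemma component_edge: "{x, y} \<in> S \<Longrightarrow> y \<in> component S x"
  by (auto simp: component_def)

lemma component_eq:
  assumes "w \<in> component S v"
  shows "component S w = component S v"
proof -
  have "sym {(x, y). {x, y} \<in> S}"
    by (auto simp: sym_def insert_commute)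
  hence "sym ({(x, y). {x, y} \<in> S}\<^sup>*)"
    by (rule sym_rtrancl)
  with assms show ?thesis
    unfolding component_def by (auto dest: symD intro: rtrancl_trans)
qed

text \<open>An invariant preserved along edges confines the whole component. Upper bounds on
  components rest on this: the vertex range, images under maps, and the colour classes of the
  construction.\<close>

lemma component_closed:
  assumes "v \<in> A" and "\<And>x y. {x, y} \<in> S \<Longrightarrow> x \<in> A \<Longrightarrow> y \<in> A"
  shows "component S v \<subseteq> A"
proof
  fix w assume "w \<in> component S v"
  hence "(v, w) \<in> {(x, y). {x, y} \<in> S}\<^sup>*" by (simp add: component_def)
  thus "w \<in> A"
    by (induction rule: rtrancl_induct) (use assms in auto)
qed

text \<open>Moves connectedness from one copy of the graph, viewed on \<open>{1..n}\<close>, into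
  the product graph by taking \<open>f\<close> to be \<open>Pair i\<close>.\<close>

lemma component_image:
  assumes "w \<in> component T v" and "\<And>x y. {x, y} \<in> T \<Longrightarrow> {f x, f y} \<in> S"
  shows "f w \<in> component S (f v)"
proof -
  have "component T v \<subseteq> {w. f w \<in> component S (f v)}"
  proof (rule component_closed)
    fix x y assume xy: "{x, y} \<in> T" "x \<in> {w. f w \<in> component S (f v)}"
    hence "component S (f x) = component S (f v)" by (intro component_eq) auto
    moreover have "f y \<in> component S (f x)" using xy assms(2) by (intro component_edge) auto
    ultimately show "y \<in> {w. f w \<in> component S (f v)}" by simp
  qed simp
  with assms(1) show ?thesis by auto
qed

text \<open>The cut-off is a fixed proportion of \<open>n\<close>, so at most \<open>1 / d\<close>
  components qualify (\<open>card_large_components\<close>). This keeps both the accumulated error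
  and the later union bound over subfamilies independent of \<open>n\<close>.\<close>

definition large_components :: "nat \<Rightarrow> real \<Rightarrow> nat set set \<Rightarrow> nat set set" where
  "large_components n d T = {C \<in> component T ` {1..n}. d * real n \<le> real (card C)}"

lemma disjoint_components: "disjoint (component T ` A)"
  unfolding disjoint_def by (metis (no_types, lifting) component_eq disjoint_iff imageE)

lemma graph_onD:
  assumes "graph_on n E"
  shows "finite E" "{} \<notin> E" "\<And>e. e \<in> E \<Longrightarrow> e \<subseteq> {1..n}" "\<And>e. e \<in> E \<Longrightarrow> card e = 2"
proof -
  show sub: "\<And>e. e \<in> E \<Longrightarrow> e \<subseteq> {1..n}" and c2: "\<And>e. e \<in> E \<Longrightarrow> card e = 2"
    using assms by (auto simp: graph_on_def)
  show "finite E" by (rule finite_subset[of _ "Pow {1..n}"]) (use sub in auto)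
  show "{} \<notin> E" using c2 by force
qed

lemma component_subset:
  assumes "graph_on n E" "T \<subseteq> E" "v \<in> {1..n}"
  shows "component T v \<subseteq> {1..n}"
  by (rule component_closed) (use assms graph_onD(3)[OF assms(1)] in blast)+

lemma large_components_subset:
  assumes "graph_on n E" "T \<subseteq> E" "C \<in> large_components n d T"
  shows "C \<subseteq> {1..n}"
  using assms(3) component_subset[OF assms(1,2)] unfolding large_components_def by blast

lemma finite_large_components [simp]: "finite (large_components n d T)"
  by (simp add: large_components_def)

lemma disjoint_large_components: "disjoint (large_components n d T)"
  using disjoint_components[of T "{1..n}"]
  by (auto simp: large_components_def disjoint_def)

lemma card_large_components:
  assumes "graph_on n E" "T \<subseteq> E" "n > 0" "d > 0"
  shows "real (card (large_components n d T)) \<le> 1 / d"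
proof -
  let ?L = "large_components n d T"
  have sub: "\<Union>?L \<subseteq> {1..n}" using large_components_subset[OF assms(1,2)] by blast
  have fin: "finite C" if "C \<in> ?L" for C
    using large_components_subset[OF assms(1,2) that] finite_subset by blast
  have "card (\<Union>?L) = (\<Sum>C\<in>?L. card C)"
    using card_Union_disjoint[of ?L] disjoint_large_components fin
    by (auto simp: disjoint_def pairwise_def disjnt_def)
  moreover have "card (\<Union>?L) \<le> n" using card_mono[OF _ sub] by simp
  ultimately have "real (\<Sum>C\<in>?L. card C) \<le> real n" by linarith
  moreover have "(\<Sum>C\<in>?L. d * real n) \<le> (\<Sum>C\<in>?L. real (card C))"
    by (rule sum_mono) (auto simp: large_components_def)
  ultimately have "real (card ?L) * d * real n \<le> 1 * real n" by (simp add: algebra_simps)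
  hence "real (card ?L) * d \<le> 1" using \<open>n > 0\<close> by simp
  thus ?thesis using \<open>d > 0\<close> by (simp add: field_simps)
qed

section \<open>Counting edges inside the parts of a partition\<close>

lemma edges_in_mono: "finite E \<Longrightarrow> U \<subseteq> W \<Longrightarrow> edges_in E U \<le> edges_in E W"
  unfolding edges_in_def by (rule card_mono) auto

text \<open>A nonempty edge cannot lie in both of two disjoint sets. An empty edge would be counted
  twice on the left, hence the assumption on \<open>{}\<close>.\<close>

lemma edges_in_superadditive:
  assumes "finite E" "{} \<notin> E" "U \<inter> W = {}"
  shows "edges_in E U + edges_in E W \<le> edges_in E (U \<union> W)"
proof -
  have "e = {}" if "e \<subseteq> U" "e \<subseteq> W" for e using that assms(3) by blast
  hence "{e\<in>E. e \<subseteq> U} \<inter> {e\<in>E. e \<subseteq> W} = {}" using assms(2) by auto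
  hence "edges_in E U + edges_in E W = card ({e\<in>E. e \<subseteq> U} \<union> {e\<in>E. e \<subseteq> W})"
    unfolding edges_in_def using assms(1) by (subst card_Un_disjoint) auto
  also have "\<dots> \<le> edges_in E (U \<union> W)"
    unfolding edges_in_def using assms(1) by (intro card_mono) auto
  finally show ?thesis .
qed

text \<open>Merging small parts greedily into blocks of size at most \<open>2 * m\<close> leaves only about
  \<open>n / m\<close> blocks, so that a pseudorandomness error is paid only that often.\<close>
lemma sum_edges_in_small_parts:
  fixes m K :: real
  assumes E: "finite E" "{} \<notin> E" and V: "finite V" and "m > 0" "K \<ge> 0"
    and K: "\<And>W. W \<subseteq> V \<Longrightarrow> real (card W) \<le> 2 * m \<Longrightarrow> real (edges_in E W) \<le> K"
    and P: "finite P" "disjoint P" "\<And>C. C \<in> P \<Longrightarrow> C \<subseteq> V \<and> real (card C) \<le> m"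
  shows "(\<Sum>C\<in>P. real (edges_in E C)) \<le> (real (card V) / m + 1) * K"
proof -
  \<comment> \<open>\<open>W\<close> is the block still open. Every closed block has more than
    \<open>m\<close> vertices and contains at most \<open>K\<close> edges, so the closed blocks
    together cost at most \<open>K\<close> per \<open>m\<close> vertices outside
    \<open>W\<close>.\<close>
  have "\<exists>W\<subseteq>\<Union>P. real (card W) \<le> m \<and>
      (\<Sum>C\<in>P. real (edges_in E C)) \<le> (real (card (\<Union>P)) - real (card W)) / m * K + real (edges_in E W)"
    using P
  proof (induction P rule: finite_induct)
    case empty
    then show ?case using \<open>m > 0\<close> by (auto simp: edges_in_def)
  next
    case (insert C P)
    have "disjoint P" using insert.prems(1) by (auto simp: disjoint_def)
    then obtain W where W: "W \<subseteq> \<Union>P" "real (card W) \<le> m"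
      "(\<Sum>C\<in>P. real (edges_in E C)) \<le> (real (card (\<Union>P)) - real (card W)) / m * K + real (edges_in E W)"
      using insert by auto
    have disj: "C \<inter> \<Union>P = {}" using insert.prems(1) insert.hyps(2) by (auto simp: disjoint_def)
    have PV: "\<Union>P \<subseteq> V" and CV: "C \<subseteq> V" using insert.prems(2) by auto
    have fin: "finite (\<Union>P)" "finite C" "finite W"
      using finite_subset[OF PV V] finite_subset[OF CV V] finite_subset[OF W(1)] by auto
    have cP: "card (\<Union>(insert C P)) = card C + card (\<Union>P)"
      using fin disj by (simp add: card_Un_disjoint)
    have CW: "C \<inter> W = {}" using disj W(1) by blast
    have cW: "card (C \<union> W) = card C + card W"
      using fin CW by (simp add: card_Un_disjoint)
    have "real (edges_in E C) + real (edges_in E W) \<le> real (edges_in E (C \<union> W))"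
      using edges_in_superadditive[OF E CW] by linarith
    with W(3) have le: "(\<Sum>C\<in>insert C P. real (edges_in E C))
        \<le> (real (card (\<Union>P)) - real (card W)) / m * K + real (edges_in E (C \<union> W))"
      using insert.hyps by simp
    show ?case
    proof (cases "real (card (C \<union> W)) \<le> m")
      case True
      have "real (card (\<Union>P)) - real (card W) = real (card (\<Union>(insert C P))) - real (card (C \<union> W))"
        unfolding cP cW by simp
      with le have "(\<Sum>C\<in>insert C P. real (edges_in E C))
        \<le> (real (card (\<Union>(insert C P))) - real (card (C \<union> W))) / m * K + real (edges_in E (C \<union> W))"
        by simp
      moreover have "C \<union> W \<subseteq> \<Union>(insert C P)" using W(1) by auto
      ultimately show ?thesis using True by blast
    next
      case False
      \<comment> \<open>The block now exceeds \<open>m\<close> but not \<open>2 * m\<close>: it is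
        closed at cost \<open>K\<close>, paid for by its own vertices, and an empty block is
        opened.\<close>
      have "real (card C) \<le> m" using insert.prems(2) by auto
      hence "real (edges_in E (C \<union> W)) \<le> K"
        using CV PV W(1,2) cW by (intro K) auto
      also have "K = m / m * K" using \<open>m > 0\<close> by simp
      also have "\<dots> \<le> real (card (C \<union> W)) / m * K"
        using False \<open>m > 0\<close> \<open>K \<ge> 0\<close> by (intro mult_right_mono divide_right_mono) auto
      finally have "(\<Sum>C\<in>insert C P. real (edges_in E C))
          \<le> (real (card (\<Union>P)) - real (card W)) / m * K + real (card (C \<union> W)) / m * K"
        using le by linarith
      also have "\<dots> = real (card (\<Union>(insert C P))) / m * K"
        unfolding cP cW using \<open>m > 0\<close> by (simp add: field_simps)
      finally show ?thesis using \<open>m > 0\<close> by (intro exI[of _ "{}"]) auto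
    qed
  qed
  then obtain W where W: "W \<subseteq> \<Union>P" "real (card W) \<le> m"
      "(\<Sum>C\<in>P. real (edges_in E C)) \<le> (real (card (\<Union>P)) - real (card W)) / m * K + real (edges_in E W)"
    by blast
  have PV: "\<Union>P \<subseteq> V" using P(3) by auto
  have "real (edges_in E W) \<le> K" using W PV \<open>m > 0\<close> by (intro K) auto
  moreover have "card (\<Union>P) \<le> card V" using PV V by (rule card_mono[rotated])
  hence "(real (card (\<Union>P)) - real (card W)) / m * K \<le> real (card V) / m * K"
    using \<open>m > 0\<close> \<open>K \<ge> 0\<close> by (intro mult_right_mono divide_right_mono) auto
  ultimately show ?thesis using W(3) by (simp add: algebra_simps)
qed

text \<open>Each edge of \<open>T\<close> inside \<open>U\<close> lies in the trace on
  \<open>U\<close> of one component. Pseudorandomness turns the edge counts of the large traces into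
  squares of their sizes. There are up to \<open>1 / d\<close> of them, so a deviation of order
  \<open>d\<^sup>2\<close> per set is needed for a total error of order \<open>d\<close>. The small
  components together contain few edges.\<close>

lemma sum_square_large_components:
  fixes d p q :: real
  assumes G: "graph_on n E" "T \<subseteq> E" and pos: "q > 0" "n > 0" "0 < d" "d \<le> 1" and p: "0 \<le> p" "p \<le> 1"
    and pr: "\<And>U. U \<subseteq> {1..n} \<Longrightarrow> \<bar>real (edges_in E U) - q * real (card U) ^ 2 / 2\<bar> \<le> d\<^sup>2 * (q * real n ^ 2)"
    and U: "U \<subseteq> {1..n}" "real (edges_in T U) \<ge> p * real (edges_in E U) - d * (q * real n ^ 2)"
  shows "(\<Sum>C\<in>large_components n d T. real (card (C \<inter> U)) ^ 2)
           \<ge> p * real (card U) ^ 2 - 20 * d * real n ^ 2"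
proof -
  define Q where "Q = q * real n ^ 2"
  have Q: "Q > 0" unfolding Q_def using pos by simp
  note finE = graph_onD(1,2)[OF G(1)]
  have finT: "finite T" using G(2) finE(1) finite_subset by blast
  define L where "L = large_components n d T"
  define P where "P = component T ` {1..n}"
  have PV: "C \<subseteq> {1..n}" if "C \<in> P" for C
    using that component_subset[OF G] unfolding P_def by blast
  have LP: "L \<subseteq> P" by (auto simp: L_def P_def large_components_def)
  have finP: "finite P" by (simp add: P_def)
  have "{e\<in>T. e \<subseteq> U} \<subseteq> (\<Union>C\<in>P. {e\<in>E. e \<subseteq> C \<inter> U})"
  proof
    fix e assume e: "e \<in> {e\<in>T. e \<subseteq> U}"
    hence "card e = 2" "e \<subseteq> {1..n}" using G(2) graph_onD(3,4)[OF G(1)] by auto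
    then obtain x y where xy: "e = {x, y}" "x \<in> {1..n}" by (auto simp: card_2_iff)
    have "e \<subseteq> component T x \<inter> U" using e xy by (auto intro: component_edge)
    moreover have "component T x \<in> P" using xy(2) by (simp add: P_def)
    ultimately show "e \<in> (\<Union>C\<in>P. {e\<in>E. e \<subseteq> C \<inter> U})" using e G(2) by blast
  qed
  hence "edges_in T U \<le> card (\<Union>C\<in>P. {e\<in>E. e \<subseteq> C \<inter> U})"
    unfolding edges_in_def using finE finP by (intro card_mono) auto
  also have "\<dots> \<le> (\<Sum>C\<in>P. edges_in E (C \<inter> U))"
    unfolding edges_in_def by (rule card_UN_le[OF finP])
  finally have "real (edges_in T U) \<le> (\<Sum>C\<in>P. real (edges_in E (C \<inter> U)))"
    by (metis of_nat_mono of_nat_sum)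
  also have "\<dots> = (\<Sum>C\<in>L. real (edges_in E (C \<inter> U))) + (\<Sum>C\<in>P - L. real (edges_in E (C \<inter> U)))"
    using sum.subset_diff[OF LP finP] by (simp add: add.commute)
  finally have split: "real (edges_in T U)
      \<le> (\<Sum>C\<in>L. real (edges_in E (C \<inter> U))) + (\<Sum>C\<in>P - L. real (edges_in E (C \<inter> U)))" .
  have "(\<Sum>C\<in>L. real (edges_in E (C \<inter> U))) \<le> (\<Sum>C\<in>L. q / 2 * real (card (C \<inter> U)) ^ 2 + d\<^sup>2 * Q)"
  proof (rule sum_mono)
    fix C assume "C \<in> L"
    have "C \<inter> U \<subseteq> {1..n}" using U(1) by auto
    from pr[OF this] show "real (edges_in E (C \<inter> U)) \<le> q / 2 * real (card (C \<inter> U)) ^ 2 + d\<^sup>2 * Q"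
      unfolding Q_def by simp
  qed
  also have "\<dots> = q / 2 * (\<Sum>C\<in>L. real (card (C \<inter> U)) ^ 2) + real (card L) * (d\<^sup>2 * Q)"
    by (simp add: sum.distrib sum_distrib_left)
  also have "real (card L) * (d\<^sup>2 * Q) \<le> 1 / d * (d\<^sup>2 * Q)"
    using card_large_components[OF G pos(2,3)] Q unfolding L_def by (intro mult_right_mono) auto
  also have "1 / d * (d\<^sup>2 * Q) = d * Q" using pos by (simp add: power2_eq_square)
  finally have big: "(\<Sum>C\<in>L. real (edges_in E (C \<inter> U))) \<le> q / 2 * (\<Sum>C\<in>L. real (card (C \<inter> U)) ^ 2) + d * Q"
    by simp
  have d2: "d\<^sup>2 * Q \<le> d * Q"
    using pos Q mult_left_mono[of d 1 d] by (intro mult_right_mono) (auto simp: power2_eq_square)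
  have "(\<Sum>C\<in>P - L. real (edges_in E (C \<inter> U))) \<le> (\<Sum>C\<in>P - L. real (edges_in E C))"
    using edges_in_mono[OF finE(1)] by (intro sum_mono) simp
  \<comment> \<open>Blocks have at most \<open>2 * (d * n)\<close> vertices, hence at most
    \<open>2 * d\<^sup>2 * Q\<close> expected edges plus a deviation of
    \<open>d\<^sup>2 * Q\<close>.\<close>
  also have "\<dots> \<le> (real (card {1..n}) / (d * real n) + 1) * (3 * d\<^sup>2 * Q)"
  proof (rule sum_edges_in_small_parts[OF finE])
    fix W :: "nat set" assume W: "W \<subseteq> {1..n}" "real (card W) \<le> 2 * (d * real n)"
    have "real (card W) ^ 2 \<le> (2 * (d * real n)) ^ 2" using W(2) by (intro power_mono) auto
    hence "q / 2 * real (card W) ^ 2 \<le> q / 2 * (2 * (d * real n)) ^ 2"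
      using pos by (intro mult_left_mono) auto
    also have "\<dots> = 2 * d\<^sup>2 * Q" unfolding Q_def by (simp add: power2_eq_square)
    finally show "real (edges_in E W) \<le> 3 * d\<^sup>2 * Q" using pr[OF W(1)] unfolding Q_def by simp
  next
    show "disjoint (P - L)" using disjoint_components[of T "{1..n}"] by (auto simp: P_def disjoint_def)
    show "C \<subseteq> {1..n} \<and> real (card C) \<le> d * real n" if "C \<in> P - L" for C
      using that PV[of C] by (auto simp: L_def large_components_def P_def)
  qed (use finP pos Q in auto)
  also have "\<dots> = 3 * d * Q + 3 * d\<^sup>2 * Q" using pos by (simp add: field_simps power2_eq_square)
  also have "\<dots> \<le> 6 * d * Q" using d2 by linarith
  finally have small: "(\<Sum>C\<in>P - L. real (edges_in E (C \<inter> U))) \<le> 6 * d * Q" .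
  have "p * (q / 2 * real (card U) ^ 2 - d * Q) \<le> p * real (edges_in E U)"
    using pr[OF U(1)] d2 p unfolding Q_def by (intro mult_left_mono) auto
  moreover have "p * (d * Q) \<le> 1 * (d * Q)" using p pos Q by (intro mult_right_mono) auto
  ultimately have "q / 2 * (p * real (card U) ^ 2) - d * Q \<le> p * real (edges_in E U)"
    by (simp add: algebra_simps)
  \<comment> \<open>Nine errors \<open>d * Q\<close>: one from the loss of edges allowed in
    \<open>U(2)\<close>, one from the deviation of \<open>U\<close>, one from the large components
    and six from the small ones.\<close>
  with U(2) split big small have
    "q / 2 * (p * real (card U) ^ 2) \<le> q / 2 * (\<Sum>C\<in>L. real (card (C \<inter> U)) ^ 2) + 9 * (d * Q)"
    unfolding Q_def[symmetric] by linarith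
  also have "\<dots> = q / 2 * ((\<Sum>C\<in>L. real (card (C \<inter> U)) ^ 2) + 18 * d * real n ^ 2)"
    unfolding Q_def by (simp add: algebra_simps)
  finally have "p * real (card U) ^ 2 \<le> (\<Sum>C\<in>L. real (card (C \<inter> U)) ^ 2) + 18 * d * real n ^ 2"
    using pos by (simp only: mult_le_cancel_left_pos half_gt_zero)
  moreover have "18 * d * real n ^ 2 \<le> 20 * d * real n ^ 2" using pos by simp
  ultimately show ?thesis unfolding L_def by linarith
qed

section \<open>The deterministic part of the upper bound\<close>

text \<open>This is \<open>s\<close> of the overview. Apart from \<open>threshold_eq\<close>, it
  enters only through the quadratic equation \<open>crit_square\<close> and numerical
  bounds.\<close>

definition crit :: real where "crit = sqrt 3 - 1"

lemma crit_square: "crit\<^sup>2 = 2 - 2 * crit"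
  by (simp add: crit_def power2_eq_square algebra_simps)

lemma crit_bounds: "0.73 < crit" "crit < 0.7321"
proof -
  have "1.73 < sqrt (3::real)" by (rule real_less_rsqrt) (simp add: power2_eq_square)
  moreover have "sqrt (3::real) < 1.7321" by (rule real_less_lsqrt) (simp_all add: power2_eq_square)
  ultimately show "0.73 < crit" "crit < 0.7321" by (auto simp: crit_def)
qed

lemma threshold_eq: "4 - 2 * sqrt 3 = crit\<^sup>2"
  by (simp add: crit_square) (simp add: crit_def)

text \<open>The chord between the points \<open>(crit, 0)\<close> and \<open>(1 - crit/2, crit/2)\<close> of the circle of radius \<open>crit\<close>.\<close>
lemma chord_inequality:
  fixes a b u :: real
  assumes "0 \<le> b" "a + b \<le> u" "u \<le> 2 * a" "crit\<^sup>2 * u\<^sup>2 < a\<^sup>2 + b\<^sup>2"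
  shows "crit * u \<le> a + (1 - crit) * b"
proof (rule ccontr)
  define s where "s = crit"
  have s: "s\<^sup>2 = 2 - 2 * s" "0.73 < s" "s < 0.7321" using crit_square crit_bounds by (auto simp: s_def)
  assume "\<not> ?thesis"
  hence lt: "a < s * u - (1 - s) * b" by (simp add: s_def)
  have u: "u \<ge> 0" using assms by linarith
  have a: "a \<ge> 0" using assms by linarith
  have "a\<^sup>2 + b\<^sup>2 \<le> s\<^sup>2 * u\<^sup>2"
  \<comment> \<open>At height \<open>s * u / 2\<close> the chord meets the line
    \<open>a + b = u\<close>. Below this height \<open>a\<close> is bounded by the chord, above it
    by the line; both bounding segments lie in the disc of radius \<open>s * u\<close>.\<close>
  proof (cases "b \<le> s * u / 2")
    case True
    have "a\<^sup>2 \<le> (s * u - (1 - s) * b)\<^sup>2" using lt a by (intro power_mono) auto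
    moreover have "(s * u - (1 - s) * b)\<^sup>2 + b\<^sup>2
        = s\<^sup>2 * u\<^sup>2 - 2 * (s - s\<^sup>2) * u * b + (2 - 2 * s + s\<^sup>2) * b\<^sup>2"
      by (simp add: power2_eq_square algebra_simps)
    moreover have "\<dots> = s\<^sup>2 * u\<^sup>2 - 2 * (3 * s - 2) * b * u + 4 * (1 - s) * b\<^sup>2"
      unfolding s(1) by (simp add: algebra_simps)
    moreover have "4 * (1 - s) * b\<^sup>2 = 4 * (1 - s) * b * b" by (simp add: power2_eq_square)
    moreover have "4 * (1 - s) * b * b \<le> 4 * (1 - s) * b * (s * u / 2)"
      using True s assms(1) by (intro mult_left_mono) auto
    moreover have "4 * (1 - s) * b * (s * u / 2) = 2 * (s - s\<^sup>2) * b * u"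
      by (simp add: power2_eq_square algebra_simps)
    moreover have "\<dots> = 2 * (3 * s - 2) * b * u"
      unfolding s(1) by (simp add: algebra_simps)
    ultimately show ?thesis by linarith
  next
    case False
    have "a\<^sup>2 \<le> (u - b)\<^sup>2" using assms a by (intro power_mono) auto
    \<comment> \<open>The line \<open>a + b = u\<close> meets the circle at the heights
      \<open>s * u / 2\<close> and \<open>(1 - s / 2) * u\<close>, and \<open>b\<close> lies between
      them. The last summand vanishes by the equation for \<open>s\<close>.\<close>
    moreover have "(u - b)\<^sup>2 + b\<^sup>2 = s\<^sup>2 * u\<^sup>2 - 2 * ((b - s * u / 2) * ((1 - s / 2) * u - b)) + (1 - s - s\<^sup>2 / 2) * u\<^sup>2"
      by (simp add: power2_eq_square field_simps)
    moreover have "(1 - s - s\<^sup>2 / 2) * u\<^sup>2 = 0" by (simp add: s(1))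
    moreover have "b \<le> u / 2" using assms by linarith
    moreover have "1 / 2 * u \<le> (1 - s / 2) * u" using s u by (intro mult_right_mono) auto
    moreover from calculation have "0 \<le> (b - s * u / 2) * ((1 - s / 2) * u - b)"
      using False by (intro mult_nonneg_nonneg) linarith+
    ultimately show ?thesis by linarith
  qed
  thus False using assms(4) by (simp add: s_def)
qed

lemma sum_square_le_square_sum:
  fixes f :: "'a \<Rightarrow> real"
  assumes "finite A" "\<And>x. x \<in> A \<Longrightarrow> f x \<ge> 0"
  shows "(\<Sum>x\<in>A. (f x)\<^sup>2) \<le> (\<Sum>x\<in>A. f x)\<^sup>2"
  using assms
proof (induction A rule: finite_induct)
  case (insert x A)
  have "f x \<ge> 0" "sum f A \<ge> 0" using insert by (auto intro: sum_nonneg)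
  hence "f x * sum f A \<ge> 0" by simp
  thus ?case using insert by (simp add: power2_sum)
qed simp

text \<open>Merging all parts of a class into one only increases the sum of squares, so every split
  of \<open>L\<close> yields a point to which \<open>chord_inequality\<close> applies. For the first
  claim, bounding the sum of squares by the maximum times the sum shows that the largest part
  exceeds half of \<open>U\<close>. The chord, with \<open>u - c\<close> as a crude bound for the
  rest, then pushes it up to the end point \<open>1 - crit / 2\<close>.\<close>

lemma dominant_part:
  fixes U :: "nat set"
  assumes L: "finite L" "disjoint L" and U: "finite U" "U \<noteq> {}"
    and sq: "crit\<^sup>2 * real (card U) ^ 2 < (\<Sum>C\<in>L. real (card (C \<inter> U)) ^ 2)"
  shows "\<exists>C\<in>L. (1 - crit / 2) * real (card U) \<le> real (card (C \<inter> U))"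
    and "D \<subseteq> L \<Longrightarrow> real (card U) \<le> 2 * real (card (\<Union>D \<inter> U)) \<Longrightarrow>
       crit * real (card U) \<le> real (card (\<Union>D \<inter> U)) + (1 - crit) * real (card (\<Union>(L - D) \<inter> U))"
proof -
  define u where "u = real (card U)"
  have u: "u > 0" using U by (simp add: u_def card_gt_0_iff)
  have disj: "C \<inter> C' = {}" if "C \<in> L" "C' \<in> L" "C \<noteq> C'" for C C'
    using L(2) that unfolding disjoint_def by blast
  have cardU: "real (card (\<Union>D \<inter> U)) = (\<Sum>C\<in>D. real (card (C \<inter> U)))" if "D \<subseteq> L" for D
  proof -
    have "\<Union>D \<inter> U = (\<Union>C\<in>D. C \<inter> U)" by blast
    also have "card \<dots> = (\<Sum>C\<in>D. card (C \<inter> U))"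
    proof (rule card_UN_disjoint)
      show "finite D" using that L(1) finite_subset by blast
      show "\<forall>C\<in>D. finite (C \<inter> U)" using U by simp
      show "\<forall>C\<in>D. \<forall>C'\<in>D. C \<noteq> C' \<longrightarrow> C \<inter> U \<inter> (C' \<inter> U) = {}"
        using disj that by blast
    qed
    finally show ?thesis by simp
  qed
  have le: "real (card (\<Union>D \<inter> U)) + real (card (\<Union>(L - D) \<inter> U)) \<le> u" if "D \<subseteq> L" for D
  proof -
    have "(\<Union>D \<inter> U) \<inter> (\<Union>(L - D) \<inter> U) = {}"
    proof (rule equals0I)
      fix x assume "x \<in> (\<Union>D \<inter> U) \<inter> (\<Union>(L - D) \<inter> U)"
      then obtain C C' where "C \<in> D" "C' \<in> L - D" "x \<in> C \<inter> C'" by blast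
      moreover from this that have "C \<noteq> C'" "C \<in> L" "C' \<in> L" by auto
      ultimately show False using disj by blast
    qed
    hence "card (\<Union>D \<inter> U) + card (\<Union>(L - D) \<inter> U) = card ((\<Union>D \<inter> U) \<union> (\<Union>(L - D) \<inter> U))"
      using U by (intro card_Un_disjoint[symmetric]) auto
    also have "\<dots> \<le> card U" using U by (intro card_mono) auto
    finally show ?thesis unfolding u_def by linarith
  qed
  have sq2: "crit\<^sup>2 * u\<^sup>2 < (real (card (\<Union>D \<inter> U)))\<^sup>2 + (real (card (\<Union>(L - D) \<inter> U)))\<^sup>2" if "D \<subseteq> L" for D
  proof -
    have "finite D" using that L(1) finite_subset by blast
    have "(\<Sum>C\<in>L. real (card (C \<inter> U)) ^ 2) = (\<Sum>C\<in>L - D. real (card (C \<inter> U)) ^ 2) + (\<Sum>C\<in>D. real (card (C \<inter> U)) ^ 2)"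
      by (rule sum.subset_diff[OF that L(1)])
    also have "\<dots> \<le> (\<Sum>C\<in>L - D. real (card (C \<inter> U)))\<^sup>2 + (\<Sum>C\<in>D. real (card (C \<inter> U)))\<^sup>2"
      using \<open>finite D\<close> L(1) by (intro add_mono sum_square_le_square_sum) auto
    finally show ?thesis using sq cardU[OF that] cardU[of "L - D"] unfolding u_def by simp
  qed
  show chord: "crit * real (card U) \<le> real (card (\<Union>D \<inter> U)) + (1 - crit) * real (card (\<Union>(L - D) \<inter> U))"
    if "D \<subseteq> L" "real (card U) \<le> 2 * real (card (\<Union>D \<inter> U))" for D
    using le[OF that(1)] sq2[OF that(1)] that(2) unfolding u_def by (intro chord_inequality) auto
  have "L \<noteq> {}"
  proof
    assume "L = {}"
    hence "crit\<^sup>2 * u\<^sup>2 < 0" using sq by (simp add: u_def)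
    moreover have "crit\<^sup>2 * u\<^sup>2 \<ge> 0" by simp
    ultimately show False by linarith
  qed
  obtain C where C: "C \<in> L" "\<And>C'. C' \<in> L \<Longrightarrow> card (C' \<inter> U) \<le> card (C \<inter> U)"
  proof -
    have "Max ((\<lambda>C. card (C \<inter> U)) ` L) \<in> (\<lambda>C. card (C \<inter> U)) ` L"
      using L(1) \<open>L \<noteq> {}\<close> by (intro Max_in) auto
    then obtain C where "C \<in> L" "Max ((\<lambda>C. card (C \<inter> U)) ` L) = card (C \<inter> U)" by auto
    thus ?thesis using that[of C] L(1) by (metis Max_ge finite_imageI imageI)
  qed
  define c where "c = real (card (C \<inter> U))"
  have "(\<Sum>C'\<in>L. real (card (C' \<inter> U)) ^ 2) \<le> (\<Sum>C'\<in>L. c * real (card (C' \<inter> U)))"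
    unfolding c_def power2_eq_square using C(2) by (intro sum_mono mult_right_mono) auto
  also have "\<dots> = c * real (card (\<Union>L \<inter> U))" using cardU[of L] by (simp add: sum_distrib_left)
  also have "\<dots> \<le> c * u" using le[of L] unfolding c_def by (intro mult_left_mono) auto
  finally have "crit\<^sup>2 * u * u < c * u" using sq unfolding u_def by (simp add: power2_eq_square)
  hence "crit\<^sup>2 * u < c" using u by simp
  moreover have "crit\<^sup>2 * u \<ge> 1/2 * u" using u crit_bounds crit_square by (intro mult_right_mono) auto
  ultimately have half: "u \<le> 2 * c" by simp
  have "crit * u \<le> c + (1 - crit) * real (card (\<Union>(L - {C}) \<inter> U))"
    using chord[of "{C}"] C(1) half by (simp add: c_def u_def)
  also have "\<dots> \<le> c + (1 - crit) * (u - c)"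
    using le[of "{C}"] C(1) crit_bounds by (intro add_left_mono mult_left_mono) (auto simp: c_def)
  finally have "crit * c \<ge> (2 * crit - 1) * u" by (simp add: algebra_simps)
  moreover have "(2 * crit - 1) * u = crit * ((1 - crit / 2) * u)"
  proof -
    have "crit * (1 - crit / 2) = crit - crit\<^sup>2 / 2" by (simp add: power2_eq_square algebra_simps)
    also have "\<dots> = 2 * crit - 1" unfolding crit_square by (simp add: field_simps)
    finally show ?thesis by (metis mult.assoc)
  qed
  ultimately have "(1 - crit / 2) * u \<le> c" using crit_bounds by simp
  thus "\<exists>C\<in>L. (1 - crit / 2) * real (card U) \<le> real (card (C \<inter> U))"
    using C(1) unfolding c_def u_def by blast
qed

text \<open>The edges of copy \<open>i\<close> are pulled back to \<open>{1..n}\<close>, so that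
  both copies are compared with the same graph \<open>E\<close>.\<close>

definition side_edges :: "nat \<Rightarrow> nat set set \<Rightarrow> (nat \<times> nat) set set \<Rightarrow> nat set set" where
  "side_edges i E S = {e \<in> E. Pair i ` e \<in> S}"

lemma side_edges_subset: "side_edges i E S \<subseteq> E"
  by (auto simp: side_edges_def)

text \<open>A component of one copy stays connected in \<open>S\<close>, so a component of
  \<open>S\<close> contains it or misses it. This allows large components to be classified as inside
  or outside \<open>K\<close>.\<close>

lemma large_component_trapped:
  assumes "C \<in> large_components n d (side_edges i E S)" "w \<in> C" "(i, w) \<in> component S v"
  shows "Pair i ` C \<subseteq> component S v"
proof (rule image_subsetI)
  fix z assume z: "z \<in> C"
  have "C = component (side_edges i E S) w"
    using assms(1,2) component_eq by (fastforce simp: large_components_def)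
  hence "(i, z) \<in> component S (i, w)"
    using component_image[of z "side_edges i E S" w "Pair i" S] z by (auto simp: side_edges_def)
  thus "(i, z) \<in> component S v" using component_eq[OF assms(3)] by simp
qed

text \<open>All randomness is confined to \<open>edges\<close> and \<open>vert\<close>. The former
  is demanded only for complements of unions of large components of the opposite copy: few enough
  sets for a union bound, and independent of the copy whose edges are counted.\<close>

lemma left_meets_right_of_edge_counts:
  fixes d p q :: real
  assumes G: "graph_on n E" and pos: "q > 0" "n > 0" and p: "crit\<^sup>2 < p" "p \<le> 1" and d: "d = (p - crit\<^sup>2) / 100"
    and pr: "\<And>U. U \<subseteq> {1..n} \<Longrightarrow> \<bar>real (edges_in E U) - q * real (card U) ^ 2 / 2\<bar> \<le> d\<^sup>2 * (q * real n ^ 2)"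
    and edges: "\<And>i j D. (i, j) \<in> {(1, 2), (2, 1)} \<Longrightarrow> D \<subseteq> large_components n d (side_edges j E S) \<Longrightarrow>
      p * real (edges_in E ({1..n} - \<Union>D)) - d * (q * real n ^ 2) \<le> real (edges_in (side_edges i E S) ({1..n} - \<Union>D))"
    and vert: "(p - d) * real n < real (card {v \<in> {1..n}. {(1, v), (2, v)} \<in> S})"
  shows "left_meets_right n S"
proof (rule ccontr)
  assume not_meet: "\<not> left_meets_right n S"
  define t where "t = 1 - crit / 2"
  have t: "63 / 100 < t" using crit_bounds by (simp add: t_def)
  have d01: "0 < d" "d \<le> 1" using p by (auto simp: d intro: order_trans[of _ p])
  define L where "L i = large_components n d (side_edges i E S)" for i
  have LV: "C \<subseteq> {1..n}" if "C \<in> L i" for C i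
    using that large_components_subset[OF G side_edges_subset] by (auto simp: L_def)
  have finC: "finite C" if "C \<in> L i" for C i
    using LV[OF that] finite_subset by blast
  have disjL: "C \<inter> C' = {}" if "C \<in> L i" "C' \<in> L i" "C \<noteq> C'" for C C' i
    using disjoint_large_components that unfolding L_def disjoint_def by blast
  \<comment> \<open>The error \<open>20 * d * n\<^sup>2\<close> is at most \<open>80 * d * \<bar>U\<bar>\<^sup>2\<close>, hence the factor 100 in the choice of \<open>d\<close>.\<close>
  have sq: "crit\<^sup>2 * real (card U) ^ 2 < (\<Sum>C\<in>L i. real (card (C \<inter> U)) ^ 2)"
    if ij: "(i, j) \<in> {(1, 2), (2, 1)}" "D \<subseteq> L j" and U: "U = {1..n} - \<Union>D" "real n \<le> 2 * real (card U)" for i j :: nat and D U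
  proof -
    define u where "u = real (card U)"
    have u: "u > 0" using U pos by (simp add: u_def)
    have "p * u\<^sup>2 - 20 * d * real n ^ 2 \<le> (\<Sum>C\<in>L i. real (card (C \<inter> U)) ^ 2)"
      unfolding L_def u_def
    proof (rule sum_square_large_components[OF G side_edges_subset pos d01 _ p(2) pr])
      show "0 \<le> p" using p(1) by (smt (verit) zero_le_power2)
      show "p * real (edges_in E U) - d * (q * real n ^ 2) \<le> real (edges_in (side_edges i E S) U)"
        using edges[OF ij[unfolded L_def]] U(1) by simp
    qed (use U in auto)
    moreover have "real n ^ 2 \<le> (2 * u) ^ 2" using U(2) by (intro power_mono) (auto simp: u_def)
    hence "20 * d * real n ^ 2 \<le> 20 * d * (2 * u) ^ 2" using d01 by (intro mult_left_mono) auto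
    moreover have "p * u\<^sup>2 - 20 * d * (2 * u) ^ 2 = crit\<^sup>2 * u\<^sup>2 + 20 * (d * u\<^sup>2)"
      unfolding d by (simp add: power2_eq_square field_simps)
    moreover have "d * u\<^sup>2 > 0" using d01 u by simp
    ultimately show ?thesis unfolding u_def by linarith
  qed
  note dom = dominant_part[OF finite_large_components[of n d "side_edges i E S" for i, folded L_def]
      disjoint_large_components[of n d "side_edges i E S" for i, folded L_def]]
  have giant: "\<exists>A\<in>L i. t * real n \<le> real (card A)" if "(i, j) \<in> {(1, 2), (2, 1)}" for i j :: nat
  proof -
    have "\<exists>C\<in>L i. (1 - crit / 2) * real (card {1..n}) \<le> real (card (C \<inter> {1..n}))"
      by (rule dom(1)[OF _ _ sq[OF that, of "{}"]]) (use pos in auto)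
    then obtain C where C: "C \<in> L i" "t * real n \<le> real (card (C \<inter> {1..n}))" by (auto simp: t_def)
    moreover have "C \<inter> {1..n} = C" using LV[OF C(1)] by auto
    ultimately show ?thesis by auto
  qed
  have chord: "crit * real (card U) \<le> real (card (\<Union>D' \<inter> U)) + (1 - crit) * real (card (\<Union>(L i - D') \<inter> U))"
    if ij: "(i, j) \<in> {(1, 2), (2, 1)}" "D \<subseteq> L j" and U: "U = {1..n} - \<Union>D" "t * real n \<le> real (card U)"
      and A: "A \<in> L i" "t * real n \<le> real (card A)" and D': "D' \<subseteq> L i" "A \<in> D'" for i j :: nat and D U A D'
  proof -
    have "1 / 2 * real n \<le> t * real n" using t by (intro mult_right_mono) auto
    hence half: "real n \<le> 2 * real (card U)" using U(2) by linarith
    have "card U > 0" using half pos by linarith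
    hence U': "finite U" "U \<noteq> {}" by (auto simp: card_gt_0_iff)
    note sqU = sq[OF ij U(1) half]
    obtain C where C: "C \<in> L i" "t * real (card U) \<le> real (card (C \<inter> U))"
      using dom(1)[OF U' sqU] by (auto simp: t_def)
    \<comment> \<open>Otherwise the giant \<open>A\<close> and the part dominating \<open>U\<close>
      are disjoint, with at least \<open>t * n\<close> and \<open>t * t * n\<close> vertices. This
      is impossible because \<open>t + t * t > 1\<close> for \<open>t > 63 / 100\<close>.\<close>
    have "C = A"
    proof (rule ccontr)
      assume "C \<noteq> A"
      hence "card C + card A = card (C \<union> A)"
        using disjL[OF C(1) A(1)] finC C(1) A(1) by (simp add: card_Un_disjoint)
      also have "\<dots> \<le> card {1..n}" using LV[OF C(1)] LV[OF A(1)] by (intro card_mono) auto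
      finally have "real (card C) + real (card A) \<le> real n" by simp
      moreover have "real (card (C \<inter> U)) \<le> real (card C)"
        using finC[OF C(1)] by (simp add: card_mono)
      moreover have "t * (t * real n) \<le> t * real (card U)" using U(2) t by (intro mult_left_mono) auto
      moreover have "63 / 100 * (t * real n) \<le> t * (t * real n)" using t by (intro mult_right_mono) auto
      moreover have "63 / 100 * real n \<le> t * real n" using t by (intro mult_right_mono) auto
      ultimately show False using C(2) A(2) pos by linarith
    qed
    have "1 / 2 * real (card U) \<le> t * real (card U)" using t by (intro mult_right_mono) auto
    also have "\<dots> \<le> real (card (A \<inter> U))" using C(2) \<open>C = A\<close> by simp
    also have "\<dots> \<le> real (card (\<Union>D' \<inter> U))" using U' D' by (intro of_nat_mono card_mono) auto
    finally show ?thesis using D'(1) by (intro dom(2)[OF U' sqU]) auto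
  qed
  obtain A where A: "A \<in> L 1" "t * real n \<le> real (card A)" using giant[of 1 2] by auto
  obtain B where B: "B \<in> L 2" "t * real n \<le> real (card B)" using giant[of 2 1] by auto
  have tn: "real n < 2 * (t * real n)"
    using mult_strict_right_mono[of "1/2" t "real n"] t pos by simp
  hence "A \<noteq> {}" using A(2) by auto
  then obtain a where a: "a \<in> A" by blast
  define K where "K = component S (1, a)"
  have trapped: "Pair i ` C \<subseteq> K" if "C \<in> L i" "w \<in> C" "(i, w) \<in> K" for C i w
    using large_component_trapped[of C n d i E S w] that by (simp add: L_def K_def)
  have AK: "Pair 1 ` A \<subseteq> K" using trapped[OF A(1) a] by (simp add: K_def)
  have BK: "\<not> Pair 2 ` B \<subseteq> K"
  proof
    assume BK: "Pair 2 ` B \<subseteq> K"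
    have big: "n < 2 * card (K \<inter> {i} \<times> {1..n})" if "C \<in> L i" "t * real n \<le> real (card C)" "Pair i ` C \<subseteq> K" for C i
    proof -
      have "card C = card (Pair i ` C)" by (simp add: card_image inj_on_def)
      also have "\<dots> \<le> card (K \<inter> {i} \<times> {1..n})" using that(3) LV[OF that(1)] by (intro card_mono) auto
      finally show ?thesis using tn that(2) by linarith
    qed
    have "(1, a) \<in> {1, 2} \<times> {1..n}" using a LV[OF A(1)] by auto
    thus False using not_meet big[OF A AK] big[OF B BK]
      unfolding left_meets_right_def K_def by blast
  qed
  \<comment> \<open>The two sides are oriented oppositely: \<open>A\<close> belongs to
    \<open>D1\<close>, inside \<open>K\<close>, but \<open>B\<close> belongs to \<open>D2\<close>,
    outside \<open>K\<close>. So the first class contains the dominating part in both chord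
    inequalities.\<close>
  define D1 where "D1 = {C \<in> L 1. Pair 1 ` C \<subseteq> K}"
  define D2 where "D2 = {C \<in> L 2. \<not> Pair 2 ` C \<subseteq> K}"
  define X1 where "X1 = \<Union>D1"
  define X2 where "X2 = \<Union>(L 1 - D1)"
  define Y1 where "Y1 = \<Union>D2"
  define Y2 where "Y2 = \<Union>(L 2 - D2)"
  have X1: "(1, v) \<in> K" if "v \<in> X1" for v using that by (auto simp: X1_def D1_def)
  have X2: "(1, v) \<notin> K" if "v \<in> X2" for v using that trapped[of _ 1 v] by (auto simp: X2_def D1_def)
  have Y1: "(2, v) \<notin> K" if "v \<in> Y1" for v using that trapped[of _ 2 v] by (auto simp: Y1_def D2_def)
  have Y2: "(2, v) \<in> K" if "v \<in> Y2" for v using that by (auto simp: Y2_def D2_def)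
  have sub: "X1 \<subseteq> {1..n}" "X2 \<subseteq> {1..n}" "Y1 \<subseteq> {1..n}" "Y2 \<subseteq> {1..n}"
    using LV[of _ 1] LV[of _ 2] unfolding X1_def X2_def Y1_def Y2_def D1_def D2_def by blast+
  have fin: "finite X1" "finite X2" "finite Y1" "finite Y2"
    using sub finite_subset[OF _ finite_atLeastAtMost] by blast+
  have disj: "X1 \<inter> X2 = {}" "Y1 \<inter> Y2 = {}" using X1 X2 Y1 Y2 by blast+
  \<comment> \<open>\<open>U\<close> avoids a union of large right components and contains
    \<open>B\<close>; \<open>W\<close> avoids a union of large left components and contains
    \<open>A\<close>. Hence both have the \<open>t * n\<close> vertices required by
    \<open>chord\<close>.\<close>
  define U where "U = {1..n} - Y2"
  define W where "W = {1..n} - X2"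
  have "B \<subseteq> Y1" using B(1) BK by (auto simp: Y1_def D2_def)
  hence "B \<subseteq> U" using disj(2) sub by (auto simp: U_def)
  hence "card B \<le> card U" by (intro card_mono) (auto simp: U_def)
  hence chordU: "crit * real (card U) \<le> real (card (X1 \<inter> U)) + (1 - crit) * real (card (X2 \<inter> U))"
    unfolding X1_def X2_def using A AK B(2)
    by (intro chord[of 1 2 "L 2 - D2" _ A]) (auto simp: U_def Y2_def D1_def)
  have "A \<subseteq> X1" using A(1) AK by (auto simp: X1_def D1_def)
  hence "A \<subseteq> W" using disj(1) sub by (auto simp: W_def)
  hence "card A \<le> card W" by (intro card_mono) (auto simp: W_def)
  hence chordW: "crit * real (card W) \<le> real (card (Y1 \<inter> W)) + (1 - crit) * real (card (Y2 \<inter> W))"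
    unfolding Y1_def Y2_def using B BK A(2)
    by (intro chord[of 2 1 "L 1 - D1" _ B]) (auto simp: W_def X2_def D2_def)
  have cards: "real (card U) = real n - real (card Y2)" "real (card W) = real n - real (card X2)"
    using card_mono[OF _ sub(4)] card_mono[OF _ sub(2)] sub fin
    by (auto simp: U_def W_def card_Diff_subset)
  have diff: "real (card (P \<inter> ({1..n} - R))) = real (card P) - real (card (P \<inter> R))"
    if "P \<subseteq> {1..n}" for P R :: "nat set"
  proof -
    have "finite P" using that finite_subset by blast
    moreover have "P \<inter> ({1..n} - R) = P - P \<inter> R" using that by auto
    ultimately show ?thesis
      using card_mono[of P "P \<inter> R"] by (simp add: card_Diff_subset)
  qed
  have "crit * (real n - real (card Y2)) \<le> real (card X1) - real (card (X1 \<inter> Y2))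
      + (1 - crit) * (real (card X2) - real (card (X2 \<inter> Y2)))"
    using chordU diff[OF sub(1), of Y2] diff[OF sub(2), of Y2] cards(1) by (simp add: U_def)
  moreover have "crit * (real n - real (card X2)) \<le> real (card Y1) - real (card (X2 \<inter> Y1))
      + (1 - crit) * (real (card Y2) - real (card (X2 \<inter> Y2)))"
    using chordW diff[OF sub(3), of X2] diff[OF sub(4), of X2] cards(2) by (simp add: W_def Int_commute)
  \<comment> \<open>The sizes of \<open>X2\<close> and \<open>Y2\<close> enter with weight
    \<open>1 - crit\<close> from one inequality and \<open>crit\<close> from the other, so all four
    sets end up with weight 1.\<close>
  ultimately have sum1: "2 * crit * real n \<le> real (card X1) + real (card X2) + real (card Y1) + real (card Y2)
      - real (card (X1 \<inter> Y2)) - real (card (X2 \<inter> Y1)) - 2 * (1 - crit) * real (card (X2 \<inter> Y2))"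
    by (simp add: algebra_simps)
  \<comment> \<open>Inclusion-exclusion inside \<open>{1..n}\<close>: the four sizes add up to at
    most \<open>n\<close> plus the overlap of left and right sets. The mixed overlaps
    \<open>X1 \<inter> Y2\<close> and \<open>X2 \<inter> Y1\<close> cancel against those in
    \<open>sum1\<close>.\<close>
  have "card (X1 \<union> X2 \<union> (Y1 \<union> Y2)) \<le> card {1..n}" using sub by (intro card_mono) auto
  hence "card (X1 \<union> X2) + card (Y1 \<union> Y2) \<le> n + card ((X1 \<union> X2) \<inter> (Y1 \<union> Y2))"
    using card_Un_Int[of "X1 \<union> X2" "Y1 \<union> Y2"] fin by simp
  moreover have "card (X1 \<union> X2) = card X1 + card X2" "card (Y1 \<union> Y2) = card Y1 + card Y2"
    using disj fin by (auto simp: card_Un_disjoint)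
  moreover have "(X1 \<union> X2) \<inter> (Y1 \<union> Y2) = (X1 \<inter> Y1 \<union> X2 \<inter> Y2) \<union> (X1 \<inter> Y2 \<union> X2 \<inter> Y1)" by blast
  hence "card ((X1 \<union> X2) \<inter> (Y1 \<union> Y2)) \<le> card (X1 \<inter> Y1 \<union> X2 \<inter> Y2) + card (X1 \<inter> Y2 \<union> X2 \<inter> Y1)"
    using card_Un_le by metis
  moreover have "card (X1 \<inter> Y2 \<union> X2 \<inter> Y1) \<le> card (X1 \<inter> Y2) + card (X2 \<inter> Y1)" by (rule card_Un_le)
  ultimately have "real (card X1) + real (card X2) + real (card Y1) + real (card Y2)
     \<le> real n + real (card (X1 \<inter> Y1 \<union> X2 \<inter> Y2)) + real (card (X1 \<inter> Y2)) + real (card (X2 \<inter> Y1))"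
    by linarith
  moreover have "0 \<le> 2 * (1 - crit) * real (card (X2 \<inter> Y2))" using crit_bounds by simp
  ultimately have missing: "(2 * crit - 1) * real n \<le> real (card (X1 \<inter> Y1 \<union> X2 \<inter> Y2))"
    using sum1 by (simp add: algebra_simps)
  have sub2: "X1 \<inter> Y1 \<union> X2 \<inter> Y2 \<subseteq> {1..n}" using sub by blast
  have "card {v \<in> {1..n}. {(1, v), (2, v)} \<in> S} \<le> card ({1..n} - (X1 \<inter> Y1 \<union> X2 \<inter> Y2))"
  proof (intro card_mono subsetI)
    fix v assume v: "v \<in> {v \<in> {1..n}. {(1, v), (2, v)} \<in> S}"
    hence "(2, v) \<in> component S (1, v)" "(1, v) \<in> component S (2, v)"
      by (auto intro!: component_edge simp: insert_commute)
    hence "(1, v) \<in> K \<longleftrightarrow> (2, v) \<in> K" unfolding K_def by (metis component_eq)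
    thus "v \<in> {1..n} - (X1 \<inter> Y1 \<union> X2 \<inter> Y2)" using v X1 X2 Y1 Y2 by blast
  qed simp
  hence "card {v \<in> {1..n}. {(1, v), (2, v)} \<in> S} + card (X1 \<inter> Y1 \<union> X2 \<inter> Y2) \<le> n"
    using card_mono[OF _ sub2] card_Diff_subset[OF finite_subset[OF sub2] sub2] by simp
  hence "(p - d) * real n < real n - (2 * crit - 1) * real n" using vert missing by linarith
  \<comment> \<open>The threshold appears here: the vertices not known to miss a vertical edge
    number at most \<open>(2 - 2 * crit) * n\<close>, and
    \<open>2 - 2 * crit = crit\<^sup>2\<close>.\<close>
  hence "(p - d) * real n < crit\<^sup>2 * real n" by (simp add: crit_square algebra_simps)
  hence "p - crit\<^sup>2 < d" using pos by simp
  moreover have "p - crit\<^sup>2 = 100 * d" by (simp add: d)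
  ultimately show False using d01 by linarith
qed

section \<open>One-independent measures above the threshold\<close>

text \<open>\<open>R\<close> contains the pairs that may be correlated; each adds at most 1 to the variance.\<close>
lemma prob_count_le:
  fixes M :: "'a pmf" and X :: "'i \<Rightarrow> 'a \<Rightarrow> bool" and p t :: real
  assumes F: "finite F" and t: "t > 0" and R: "R \<subseteq> F \<times> F"
    and single: "\<And>e. e \<in> F \<Longrightarrow> measure_pmf.prob M {x. X e x} = p"
    and pair: "\<And>e f. e \<in> F \<Longrightarrow> f \<in> F \<Longrightarrow> (e, f) \<notin> R \<Longrightarrow> measure_pmf.prob M {x. X e x \<and> X f x} = p * p"
  shows "measure_pmf.prob M {x. real (card {e\<in>F. X e x}) \<le> p * real (card F) - t} \<le> real (card R) / t\<^sup>2"
proof (cases "F = {}")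
  case True
  thus ?thesis using t by simp
next
  case False
  \<comment> \<open>Only through a member of \<open>F\<close> is \<open>p\<close> known to be a
    probability, whence the separate treatment of empty \<open>F\<close>.\<close>
  then obtain e0 where "e0 \<in> F" by blast
  hence p: "0 \<le> p" "p \<le> 1" using single[of e0] by (metis measure_nonneg, metis measure_pmf.prob_le_1)
  define g where "g e x = (of_bool (X e x) :: real)" for e x
  have int: "integrable (measure_pmf M) h" if "\<And>x. \<bar>h x\<bar> \<le> 1" for h :: "'a \<Rightarrow> real"
    using that by (intro measure_pmf.integrable_const_bound[where B = 1]) auto
  have g01: "\<bar>g e x\<bar> \<le> 1" "\<bar>g e x * g f x\<bar> \<le> 1" "\<bar>(g e x - p) * (g f x - p)\<bar> \<le> 1" for e f x
    using p by (auto simp: g_def abs_mult intro!: mult_le_one)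
  have Eg: "measure_pmf.expectation M (g e) = measure_pmf.prob M {x. X e x}" for e
  proof -
    have "g e = indicator {x. X e x}" by (auto simp: g_def indicator_def)
    thus ?thesis by simp
  qed
  have Egg: "measure_pmf.expectation M (\<lambda>x. g e x * g f x) = measure_pmf.prob M {x. X e x \<and> X f x}" for e f
  proof -
    have "(\<lambda>x. g e x * g f x) = indicator {x. X e x \<and> X f x}" by (auto simp: g_def indicator_def)
    thus ?thesis by simp
  qed
  have cov: "measure_pmf.expectation M (\<lambda>x. (g e x - p) * (g f x - p)) \<le> of_bool ((e, f) \<in> R)"
    if "e \<in> F" "f \<in> F" for e f
  proof (cases "(e, f) \<in> R")
    case True
    have "measure_pmf.expectation M (\<lambda>x. (g e x - p) * (g f x - p)) \<le> measure_pmf.expectation M (\<lambda>x. 1)"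
      using g01(3)[of e _ f] int[OF g01(3)] by (intro integral_mono) (auto simp: abs_le_iff)
    thus ?thesis using True by simp
  next
    case False
    have "measure_pmf.expectation M (\<lambda>x. (g e x - p) * (g f x - p))
        = measure_pmf.expectation M (\<lambda>x. g e x * g f x - p * g e x - p * g f x + p * p)"
      by (simp add: algebra_simps)
    also have "\<dots> = p * p - p * p - p * p + p * p"
      using int[OF g01(1)] int[OF g01(2)] single[OF that(1)] single[OF that(2)] pair[OF that False]
      by (simp add: Eg Egg)
    finally show ?thesis using False by simp
  qed
  define Y where "Y x = (\<Sum>e\<in>F. g e x - p)\<^sup>2" for x
  have Y: "Y x = (\<Sum>e\<in>F. \<Sum>f\<in>F. (g e x - p) * (g f x - p))" for x
    by (simp add: Y_def power2_eq_square sum_product)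
  have intY: "integrable (measure_pmf M) Y"
    unfolding Y using int[OF g01(3)] by (intro Bochner_Integration.integrable_sum) auto
  have "measure_pmf.expectation M Y = (\<Sum>e\<in>F. \<Sum>f\<in>F. measure_pmf.expectation M (\<lambda>x. (g e x - p) * (g f x - p)))"
    unfolding Y using int[OF g01(3)] by (simp add: Bochner_Integration.integral_sum Bochner_Integration.integrable_sum)
  also have "\<dots> \<le> (\<Sum>e\<in>F. \<Sum>f\<in>F. of_bool ((e, f) \<in> R))" using cov by (intro sum_mono) auto
  also have "\<dots> = (\<Sum>z\<in>F \<times> F. of_bool (z \<in> R))" by (simp add: sum.cartesian_product)
  also have "\<dots> = real (card (F \<times> F \<inter> R))" using F by (simp add: of_bool_def sum.If_cases)
  also have "F \<times> F \<inter> R = R" using R by blast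
  finally have EY: "measure_pmf.expectation M Y \<le> real (card R)" .
  have "{x. real (card {e\<in>F. X e x}) \<le> p * real (card F) - t} \<subseteq> {x. t\<^sup>2 \<le> Y x}"
  proof
    fix x assume "x \<in> {x. real (card {e\<in>F. X e x}) \<le> p * real (card F) - t}"
    moreover have "(\<Sum>e\<in>F. g e x - p) = real (card {e\<in>F. X e x}) - p * real (card F)"
      using F by (simp add: g_def sum_subtractf of_bool_def sum.If_cases Int_def)
    ultimately have "t \<le> - (\<Sum>e\<in>F. g e x - p)" by simp
    hence "t\<^sup>2 \<le> (- (\<Sum>e\<in>F. g e x - p))\<^sup>2" using t by (intro power_mono) auto
    thus "x \<in> {x. t\<^sup>2 \<le> Y x}" by (simp add: Y_def)
  qed
  hence "measure_pmf.prob M {x. real (card {e\<in>F. X e x}) \<le> p * real (card F) - t} \<le> measure_pmf.prob M {x. t\<^sup>2 \<le> Y x}"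
    by (intro measure_pmf.finite_measure_mono) auto
  also have "\<dots> \<le> measure_pmf.expectation M Y / t\<^sup>2"
  proof -
    have "Y x \<ge> 0" for x by (simp add: Y_def)
    thus ?thesis using integral_Markov_inequality_measure[OF intY, of UNIV "t\<^sup>2"] t by simp
  qed
  also have "\<dots> \<le> real (card R) / t\<^sup>2" using EY by (intro divide_right_mono) auto
  finally show ?thesis .
qed

text \<open>Fubini: the first coordinate is fixed. A set chosen by one copy can then be treated as
  constant while the other copy is tested on it.\<close>

lemma prob_pair_pmf_le:
  assumes "\<And>b. b \<in> set_pmf N \<Longrightarrow> measure_pmf.prob M {a. Q b a} \<le> c" and "c \<ge> 0"
  shows "measure_pmf.prob (pair_pmf N M) {(b, a). Q b a} \<le> c"
proof -
  have "emeasure (pair_pmf N M) {(b, a). Q b a} = (\<integral>\<^sup>+z. indicator {(b, a). Q b a} z \<partial>pair_pmf N M)"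
    by simp
  also have "\<dots> = (\<integral>\<^sup>+b. \<integral>\<^sup>+a. indicator {a. Q b a} a \<partial>M \<partial>N)"
    unfolding nn_integral_pair_pmf' by (intro nn_integral_cong) (auto simp: indicator_def)
  also have "\<dots> = (\<integral>\<^sup>+b. emeasure M {a. Q b a} \<partial>N)" by simp
  also have "\<dots> \<le> (\<integral>\<^sup>+b. ennreal c \<partial>N)"
    using assms by (intro nn_integral_mono_AE) (auto simp: AE_measure_pmf_iff measure_pmf.emeasure_eq_measure)
  also have "\<dots> = ennreal c" by simp
  finally show ?thesis using assms(2) by (simp add: measure_pmf.emeasure_eq_measure)
qed

section \<open>Consequences of 1-independence\<close>

lemma one_independentD:
  assumes "one_independent H \<mu>" "A \<subseteq> H" "B \<subseteq> H" "\<Union>A \<inter> \<Union>B = {}"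
  shows "measure_pmf.prob \<mu> {S. S \<inter> A = a \<and> S \<inter> B = b}
      = measure_pmf.prob \<mu> {S. S \<inter> A = a} * measure_pmf.prob \<mu> {S. S \<inter> B = b}"
  using assms(1)[unfolded one_independent_def, rule_format, of A B a b] assms(2-4) by simp

text \<open>1-independence factorises the point probabilities of the pair of restrictions, which
  identifies its law as a product. In this form it applies to arbitrary events on the two
  restrictions.\<close>

lemma one_independent_pair_pmf:
  assumes "one_independent H \<mu>" "A \<subseteq> H" "B \<subseteq> H" "\<Union>A \<inter> \<Union>B = {}"
  shows "map_pmf (\<lambda>S. (S \<inter> A, S \<inter> B)) \<mu> = pair_pmf (map_pmf (\<lambda>S. S \<inter> A) \<mu>) (map_pmf (\<lambda>S. S \<inter> B) \<mu>)"
proof (rule pmf_eqI)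
  fix z :: "'a set set \<times> 'a set set"
  obtain a b where z: "z = (a, b)" by force
  show "pmf (map_pmf (\<lambda>S. (S \<inter> A, S \<inter> B)) \<mu>) z = pmf (pair_pmf (map_pmf (\<lambda>S. S \<inter> A) \<mu>) (map_pmf (\<lambda>S. S \<inter> B) \<mu>)) z"
    unfolding z using one_independentD[OF assms] by (simp add: pmf_pair pmf_map vimage_def)
qed

lemma one_independent_prob_edges:
  assumes "one_independent H \<mu>" "e \<in> H" "f \<in> H" "e \<inter> f = {}"
  shows "measure_pmf.prob \<mu> {S. e \<in> S \<and> f \<in> S} = measure_pmf.prob \<mu> {S. e \<in> S} * measure_pmf.prob \<mu> {S. f \<in> S}"
proof -
  have "measure_pmf.prob \<mu> {S. S \<inter> {e} = {e} \<and> S \<inter> {f} = {f}}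
      = measure_pmf.prob \<mu> {S. S \<inter> {e} = {e}} * measure_pmf.prob \<mu> {S. S \<inter> {f} = {f}}"
    using assms by (intro one_independentD) auto
  moreover have "S \<inter> {x} = {x} \<longleftrightarrow> x \<in> S" for S and x :: "'a set" by auto
  ultimately show ?thesis by simp
qed

section \<open>Concentration and the union bound in the product graph\<close>

definition side_copy :: "nat \<Rightarrow> nat set set \<Rightarrow> (nat \<times> nat) set set" where
  "side_copy i E = (`) (Pair i) ` E"

lemma side_copy_subset:
  assumes "graph_on n E" "i \<in> {1, 2}"
  shows "side_copy i E \<subseteq> prod_K2 n E"
proof
  fix f assume "f \<in> side_copy i E"
  then obtain e where e: "e \<in> E" "f = Pair i ` e" by (auto simp: side_copy_def)
  from graph_onD(4)[OF assms(1) e(1)] obtain u v where "e = {u, v}" by (auto simp: card_2_iff)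
  hence "f = {(i, u), (i, v)}" "{u, v} \<in> E" using e by auto
  thus "f \<in> prod_K2 n E" using assms(2) unfolding prod_K2_def
    by (intro UnI1 CollectI exI[of _ i] exI[of _ u] exI[of _ v] conjI)
qed

lemma side_edges_Int_side_copy: "side_edges i E (S \<inter> side_copy i E) = side_edges i E S"
proof -
  have "Pair i ` e \<in> side_copy i E" if "e \<in> E" for e
    using that by (simp add: side_copy_def)
  thus ?thesis by (auto simp: side_edges_def)
qed

text \<open>Given \<open>e\<close>, an edge meeting it is described by one of the two ends of
  \<open>e\<close> and a second vertex. The resulting variance bound has order
  \<open>q * n ^ 3\<close>, against a squared deviation of order \<open>q\<^sup>2 * n ^ 4\<close>;
  this is where \<open>q * n\<close> must tend to infinity.\<close>

lemma card_meeting_pairs: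
  assumes G: "graph_on n E" and F: "F \<subseteq> E"
  shows "card {(e, f) \<in> F \<times> F. e \<inter> f \<noteq> {}} \<le> 2 * n * card E"
proof -
  note fin = graph_onD(1)[OF G]
  have finF: "finite F" using F fin finite_subset by blast
  have "{(e, f) \<in> F \<times> F. e \<inter> f \<noteq> {}} = Sigma F (\<lambda>e. {f \<in> F. e \<inter> f \<noteq> {}})" by auto
  hence "card {(e, f) \<in> F \<times> F. e \<inter> f \<noteq> {}} = (\<Sum>e\<in>F. card {f \<in> F. e \<inter> f \<noteq> {}})"
    using finF by simp
  also have "\<dots> \<le> (\<Sum>e\<in>F. 2 * n)"
  proof (rule sum_mono)
    fix e assume "e \<in> F"
    hence e: "card e = 2" using graph_onD(4)[OF G] F by auto
    hence fe: "finite e" using card.infinite by fastforce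
    have "{f \<in> F. e \<inter> f \<noteq> {}} \<subseteq> (\<lambda>(x, y). {x, y}) ` (e \<times> {1..n})"
    proof
      fix f assume f: "f \<in> {f \<in> F. e \<inter> f \<noteq> {}}"
      then obtain x where x: "x \<in> e" "x \<in> f" by blast
      have "card f = 2" "f \<subseteq> {1..n}" using f F graph_onD(3,4)[OF G] by auto
      then obtain a b where ab: "f = {a, b}" "a \<in> {1..n}" "b \<in> {1..n}" by (auto simp: card_2_iff)
      define y where "y = (if x = a then b else a)"
      have "f = {x, y}" "y \<in> {1..n}" using x(2) ab by (auto simp: y_def)
      thus "f \<in> (\<lambda>(x, y). {x, y}) ` (e \<times> {1..n})" using x by blast
    qed
    hence "card {f \<in> F. e \<inter> f \<noteq> {}} \<le> card ((\<lambda>(x, y). {x, y}) ` (e \<times> {1..n}))"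
      using fe by (intro card_mono) auto
    also have "\<dots> \<le> card (e \<times> {1..n})" using fe by (intro card_image_le) auto
    finally show "card {f \<in> F. e \<inter> f \<noteq> {}} \<le> 2 * n" using e by (simp add: card_cartesian_product)
  qed
  also have "\<dots> = 2 * n * card F" by simp
  also have "\<dots> \<le> 2 * n * card E" using card_mono[OF fin F] by simp
  finally show ?thesis .
qed

text \<open>The outer factor 2 counts the two orientations and \<open>2 ^ K\<close> bounds the
  number of subfamilies \<open>D\<close> of the large components. The remaining factor is
  Chebyshev's bound for one fixed vertex set, and the last term is Chebyshev's bound for the
  vertical edges.\<close>

lemma prob_not_left_meets_right_le:
  fixes d p q :: real
  assumes G: "graph_on n E" and pos: "q > 0" "n > 0" and p: "crit\<^sup>2 < p" "p \<le> 1" and d: "d = (p - crit\<^sup>2) / 100"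
    and pr: "\<And>U. U \<subseteq> {1..n} \<Longrightarrow> \<bar>real (edges_in E U) - q * real (card U) ^ 2 / 2\<bar> \<le> d\<^sup>2 * (q * real n ^ 2)"
    and \<mu>: "\<mu> \<in> M1p (prod_K2 n E) p" and K: "1 / d \<le> real K"
  shows "measure_pmf.prob \<mu> {S. \<not> left_meets_right n S}
     \<le> 2 * (2 ^ K * (2 / (d\<^sup>2 * (q * real n)))) + 1 / (d\<^sup>2 * real n)"
proof -
  let ?H = "prod_K2 n E"
  define Q where "Q = q * real n ^ 2"
  have Q: "Q > 0" using pos by (simp add: Q_def)
  have d01: "0 < d" "d \<le> 1 / 100"
  proof -
    have "0 < p - crit\<^sup>2" "p - crit\<^sup>2 \<le> 1" using p zero_le_power2[of crit] by linarith+
    thus "0 < d" "d \<le> 1 / 100" by (simp_all add: d)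
  qed
  have single: "measure_pmf.prob \<mu> {S. e \<in> S} = p" if "e \<in> ?H" for e
    using \<mu> that by (simp add: M1p_def)
  have indep: "one_independent ?H \<mu>" using \<mu> by (simp add: M1p_def)
  have "d\<^sup>2 \<le> (1 / 100)\<^sup>2" using d01 by (intro power_mono) auto
  hence "d\<^sup>2 * Q \<le> 1 / 2 * Q" using Q by (intro mult_right_mono) (auto simp: power2_eq_square)
  moreover have "edges_in E {1..n} = card E"
    using graph_onD(3)[OF G] unfolding edges_in_def by (intro arg_cong[where f = card]) auto
  ultimately have cardE: "real (card E) \<le> Q"
    using pr[of "{1..n}"] unfolding Q_def by simp
  define \<kappa> where "\<kappa> = 2 / (d\<^sup>2 * (q * real n))"
  have \<kappa>: "\<kappa> \<ge> 0" using pos by (simp add: \<kappa>_def)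
  define few where "few i U S \<longleftrightarrow> real (edges_in (side_edges i E S) U) \<le> p * real (edges_in E U) - d * Q" for i U S
  have fixed: "measure_pmf.prob \<mu> {S. few i U S} \<le> \<kappa>" if i: "i \<in> {1, 2}" for i U
  proof -
    define F where "F = {e \<in> E. e \<subseteq> U}"
    define R where "R = {(e, f) \<in> F \<times> F. e \<inter> f \<noteq> {}}"
    have H: "Pair i ` e \<in> ?H" if "e \<in> F" for e
      using that side_copy_subset[OF G i] by (auto simp: F_def side_copy_def)
    have "{S. few i U S} = {S. real (card {e \<in> F. Pair i ` e \<in> S}) \<le> p * real (card F) - d * Q}"
    proof -
      have "{e \<in> side_edges i E S. e \<subseteq> U} = {e \<in> F. Pair i ` e \<in> S}" for S
        by (auto simp: side_edges_def F_def)
      thus ?thesis by (simp add: few_def edges_in_def F_def)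
    qed
    also have "measure_pmf.prob \<mu> \<dots> \<le> real (card R) / (d * Q)\<^sup>2"
    proof (rule prob_count_le)
      show "finite F" using graph_onD(1)[OF G] by (simp add: F_def)
      show "measure_pmf.prob \<mu> {S. Pair i ` e \<in> S} = p" if "e \<in> F" for e
        using single[OF H[OF that]] .
      show "measure_pmf.prob \<mu> {S. Pair i ` e \<in> S \<and> Pair i ` f \<in> S} = p * p"
        if "e \<in> F" "f \<in> F" "(e, f) \<notin> R" for e f
      proof -
        have "e \<inter> f = {}" using that by (auto simp: R_def)
        hence "Pair i ` e \<inter> Pair i ` f = {}" by auto
        thus ?thesis using one_independent_prob_edges[OF indep H H] single[OF H] that by simp
      qed
    qed (use d01 Q in \<open>auto simp: R_def\<close>)
    also have "real (card R) \<le> real (2 * n * card E)"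
      unfolding R_def using card_meeting_pairs[OF G, of F] by (simp only: of_nat_le_iff) (auto simp: F_def)
    also have "\<dots> \<le> 2 * real n * Q" using cardE by (simp add: mult_left_mono)
    also have "2 * real n * Q / (d * Q)\<^sup>2 = \<kappa>"
      using Q pos unfolding \<kappa>_def Q_def by (simp add: power2_eq_square field_simps)
    finally show ?thesis using Q d01 by (simp add: divide_right_mono)
  qed
  define bad where "bad i j = {S. \<exists>D\<subseteq>large_components n d (side_edges j E S). few i ({1..n} - \<Union>D) S}" for i j
  have bad: "measure_pmf.prob \<mu> (bad i j) \<le> 2 ^ K * \<kappa>" if ij: "(i, j) \<in> {(1, 2), (2, 1)}" for i j
  proof -
    have i: "i \<in> {1, 2}" and j: "j \<in> {1, 2}" and ne: "i \<noteq> j" using ij by auto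
    \<comment> \<open>\<open>P\<close> separates the two roles of \<open>S\<close>: \<open>b\<close>
      is copy \<open>j\<close> and supplies the candidates for \<open>D\<close>, while
      \<open>a\<close> is copy \<open>i\<close> and is tested on them.\<close>
    define P where "P b a \<longleftrightarrow> (\<exists>D\<subseteq>large_components n d (side_edges j E b). few i ({1..n} - \<Union>D) a)" for b a
    have few_Int: "few i U (S \<inter> side_copy i E) = few i U S" for U S
      by (simp add: few_def side_edges_Int_side_copy)
    have "bad i j = (\<lambda>S. (S \<inter> side_copy j E, S \<inter> side_copy i E)) -` {(b, a). P b a}"
      by (auto simp: bad_def P_def few_Int side_edges_Int_side_copy)
    hence "measure_pmf.prob \<mu> (bad i j)
        = measure_pmf.prob (map_pmf (\<lambda>S. (S \<inter> side_copy j E, S \<inter> side_copy i E)) \<mu>) {(b, a). P b a}"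
      by simp
    also have "map_pmf (\<lambda>S. (S \<inter> side_copy j E, S \<inter> side_copy i E)) \<mu>
      = pair_pmf (map_pmf (\<lambda>S. S \<inter> side_copy j E) \<mu>) (map_pmf (\<lambda>S. S \<inter> side_copy i E) \<mu>)"
      by (rule one_independent_pair_pmf[OF indep side_copy_subset[OF G j] side_copy_subset[OF G i]])
        (use ne in \<open>auto simp: side_copy_def\<close>)
    also have "measure_pmf.prob \<dots> {(b, a). P b a} \<le> 2 ^ K * \<kappa>"
    proof (rule prob_pair_pmf_le)
      fix b
      define L where "L = large_components n d (side_edges j E b)"
      have finL: "finite L" by (simp add: L_def)
      have "real (card L) \<le> 1 / d"
        unfolding L_def by (rule card_large_components[OF G side_edges_subset pos(2) d01(1)])
      hence cL: "card L \<le> K" using K by linarith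
      have "measure_pmf.prob (map_pmf (\<lambda>S. S \<inter> side_copy i E) \<mu>) {a. P b a}
          = measure_pmf.prob \<mu> (\<Union>D\<in>Pow L. {S. few i ({1..n} - \<Union>D) S})"
        by (auto simp: P_def L_def few_Int vimage_def intro!: arg_cong[where f = "measure_pmf.prob \<mu>"])
      also have "\<dots> \<le> (\<Sum>D\<in>Pow L. measure_pmf.prob \<mu> {S. few i ({1..n} - \<Union>D) S})"
        using finL by (intro measure_pmf.finite_measure_subadditive_finite) auto
      also have "\<dots> \<le> (\<Sum>D\<in>Pow L. \<kappa>)" by (intro sum_mono fixed i)
      also have "\<dots> = 2 ^ card L * \<kappa>" using finL by (simp add: card_Pow)
      also have "\<dots> \<le> 2 ^ K * \<kappa>" using cL \<kappa> by (intro mult_right_mono power_increasing) auto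
      finally show "measure_pmf.prob (map_pmf (\<lambda>S. S \<inter> side_copy i E) \<mu>) {a. P b a} \<le> 2 ^ K * \<kappa>" .
    qed (use \<kappa> in auto)
    finally show ?thesis .
  qed
  define bad_rungs where
    "bad_rungs = {S. real (card {v \<in> {1..n}. {(1 :: nat, v), (2, v)} \<in> S}) \<le> p * real (card {1..n}) - d * real n}"
  have rungs: "measure_pmf.prob \<mu> bad_rungs \<le> 1 / (d\<^sup>2 * real n)"
  proof -
    have H: "{(1, v), (2, v)} \<in> ?H" if "v \<in> {1..n}" for v using that by (auto simp: prod_K2_def)
    have "measure_pmf.prob \<mu> bad_rungs \<le> real (card ((\<lambda>v. (v, v)) ` {1..n})) / (d * real n)\<^sup>2"
      unfolding bad_rungs_def
    proof (rule prob_count_le)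
      fix v assume v: "v \<in> {1..n}"
      show "measure_pmf.prob \<mu> {S. {(1, v), (2, v)} \<in> S} = p" using single[OF H[OF v]] .
      fix w assume w: "w \<in> {1..n}" "(v, w) \<notin> (\<lambda>v. (v, v)) ` {1..n}"
      hence "v \<noteq> w" using v by auto
      hence "{(1 :: nat, v), (2, v)} \<inter> {(1, w), (2, w)} = {}" by auto
      thus "measure_pmf.prob \<mu> {S. {(1, v), (2, v)} \<in> S \<and> {(1, w), (2, w)} \<in> S} = p * p"
        using one_independent_prob_edges[OF indep H[OF v] H[OF w(1)]] single[OF H[OF v]] single[OF H[OF w(1)]] by simp
    qed (use d01 pos in auto)
    also have "card ((\<lambda>v. (v, v)) ` {1..n}) = n" by (subst card_image) (auto simp: inj_on_def)
    also have "real n / (d * real n)\<^sup>2 = 1 / (d\<^sup>2 * real n)"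
      using pos by (simp add: power2_eq_square)
    finally show ?thesis .
  qed
  have "{S. \<not> left_meets_right n S} \<subseteq> (bad 1 2 \<union> bad 2 1) \<union> bad_rungs"
  proof (rule subsetI, rule ccontr)
    fix S assume S: "S \<in> {S. \<not> left_meets_right n S}" "S \<notin> (bad 1 2 \<union> bad 2 1) \<union> bad_rungs"
    have "left_meets_right n S"
    proof (rule left_meets_right_of_edge_counts[OF G pos p d pr])
      fix i j :: nat and D
      assume "(i, j) \<in> {(1, 2), (2, 1)}" "D \<subseteq> large_components n d (side_edges j E S)"
      hence "\<not> few i ({1..n} - \<Union>D) S" using S(2) by (auto simp: bad_def)
      thus "p * real (edges_in E ({1..n} - \<Union>D)) - d * (q * real n ^ 2)
          \<le> real (edges_in (side_edges i E S) ({1..n} - \<Union>D))"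
        by (simp add: few_def Q_def)
    next
      show "(p - d) * real n < real (card {v \<in> {1..n}. {(1, v), (2, v)} \<in> S})"
        using S(2) by (simp add: bad_rungs_def algebra_simps)
    qed
    thus False using S(1) by simp
  qed
  hence "measure_pmf.prob \<mu> {S. \<not> left_meets_right n S} \<le> measure_pmf.prob \<mu> ((bad 1 2 \<union> bad 2 1) \<union> bad_rungs)"
    by (intro measure_pmf.finite_measure_mono) auto
  also have "\<dots> \<le> measure_pmf.prob \<mu> (bad 1 2 \<union> bad 2 1) + measure_pmf.prob \<mu> bad_rungs"
    by (rule measure_Un_le) auto
  finally have "measure_pmf.prob \<mu> {S. \<not> left_meets_right n S}
      \<le> measure_pmf.prob \<mu> (bad 1 2 \<union> bad 2 1) + measure_pmf.prob \<mu> bad_rungs" .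
  moreover have "measure_pmf.prob \<mu> (bad 1 2 \<union> bad 2 1) \<le> measure_pmf.prob \<mu> (bad 1 2) + measure_pmf.prob \<mu> (bad 2 1)"
    by (rule measure_Un_le) auto
  moreover have "measure_pmf.prob \<mu> (bad 1 2) \<le> 2 ^ K * \<kappa>" "measure_pmf.prob \<mu> (bad 2 1) \<le> 2 ^ K * \<kappa>"
    by (rule bad; simp)+
  ultimately show ?thesis using rungs unfolding \<kappa>_def[symmetric] by linarith
qed

text \<open>The asymptotic hypotheses control only absolute values, so the sign of
  \<open>q n\<close> has to be derived. If it were negative, the full vertex set would deviate by at
  least half of the absolute value of \<open>q n * n ^ 2\<close>, contradicting
  \<open>c < 1 / 2\<close>.\<close>

lemma weakly_pseudorandom_eventually:
  assumes q: "(\<lambda>n. ln (real n)) \<in> o[at_top](\<lambda>n. q n * real n)"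
    and G: "weakly_pseudorandom q G" and c: "0 < c" "c < 1 / 2" and B: "B > 0"
  shows "eventually (\<lambda>n. q n > 0 \<and> B \<le> q n * real n \<and>
     (\<forall>U\<subseteq>{1..n}. \<bar>real (edges_in (G n) U) - q n * real (card U) ^ 2 / 2\<bar> \<le> c * (q n * real n ^ 2))) at_top"
proof -
  define dev where "dev n U = \<bar>real (edges_in (G n) U) - q n * real (card U) ^ 2 / 2\<bar>" for n U
  have "(\<lambda>n. Max {dev n U | U. U \<subseteq> {1..n}}) \<in> o[at_top](\<lambda>n. q n * real n ^ 2)"
    using G by (simp add: weakly_pseudorandom_def dev_def)
  hence "eventually (\<lambda>n. norm (Max {dev n U | U. U \<subseteq> {1..n}}) \<le> c * norm (q n * real n ^ 2)) at_top"
    using c(1) by (rule landau_o.smallD)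
  moreover have "eventually (\<lambda>n. norm (ln (real n)) \<le> 1 / B * norm (q n * real n)) at_top"
    using q B by (intro landau_o.smallD) auto
  moreover have "eventually (\<lambda>n. ln (real n) \<ge> 1) at_top"
    using filterlim_compose[OF ln_at_top filterlim_real_sequentially] by (simp add: filterlim_at_top)
  ultimately show ?thesis using eventually_gt_at_top[of 0]
  proof eventually_elim
    case (elim n)
    have "B * 1 \<le> B * ln (real n)" using elim(3) B by (intro mult_left_mono) auto
    moreover have "B * ln (real n) \<le> \<bar>q n\<bar> * real n"
      using elim(2,3) B by (simp add: field_simps abs_mult)
    ultimately have big: "B \<le> \<bar>q n\<bar> * real n" by linarith
    hence "q n \<noteq> 0" using B by auto
    have dev: "dev n U \<le> c * (\<bar>q n\<bar> * real n ^ 2)" if "U \<subseteq> {1..n}" for U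
    proof -
      have "{dev n U | U. U \<subseteq> {1..n}} = dev n ` Pow {1..n}" by auto
      hence "finite {dev n U | U. U \<subseteq> {1..n}}" by simp
      hence "dev n U \<le> Max {dev n U | U. U \<subseteq> {1..n}}" using that by (intro Max_ge) auto
      thus ?thesis using elim(1) by (simp add: abs_mult)
    qed
    have "q n > 0"
    proof (rule ccontr)
      assume "\<not> q n > 0"
      hence "q n < 0" using \<open>q n \<noteq> 0\<close> by simp
      hence "1 / 2 * (\<bar>q n\<bar> * real n ^ 2) \<le> dev n {1..n}" unfolding dev_def by (simp add: field_simps)
      also have "\<dots> \<le> c * (\<bar>q n\<bar> * real n ^ 2)" by (rule dev) simp
      finally have "1 / 2 \<le> c" using \<open>q n \<noteq> 0\<close> elim(4) by (simp add: mult_le_cancel_right)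
      thus False using c(2) by simp
    qed
    thus ?case using big dev unfolding dev_def by simp
  qed
qed

lemma eventually_left_meets_right:
  assumes q: "(\<lambda>n. ln (real n)) \<in> o[at_top](\<lambda>n. q n * real n)"
    and G: "\<And>n. graph_on n (G n)" "weakly_pseudorandom q G" and p: "4 - 2 * sqrt 3 < p" and \<epsilon>: "\<epsilon> > 0"
  shows "eventually (\<lambda>n. \<forall>\<mu>\<in>M1p (prod_K2 n (G n)) p. measure_pmf.prob \<mu> {S. left_meets_right n S} \<ge> 1 - \<epsilon>) at_top"
proof (cases "p \<le> 1")
  case True
  define d where "d = (p - crit\<^sup>2) / 100"
  have d: "0 < d" "d \<le> 1 / 100"
  proof -
    have "0 < p - crit\<^sup>2" "p - crit\<^sup>2 \<le> 1"
      using p True zero_le_power2[of crit] unfolding threshold_eq by linarith+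
    thus "0 < d" "d \<le> 1 / 100" by (simp_all add: d_def)
  qed
  have "d\<^sup>2 \<le> (1 / 100)\<^sup>2" using d by (intro power_mono) auto
  hence d2: "0 < d\<^sup>2" "d\<^sup>2 < 1 / 2" using d by (auto simp: power2_eq_square)
  define K where "K = nat \<lceil>1 / d\<rceil>"
  have K: "1 / d \<le> real K" unfolding K_def by linarith
  \<comment> \<open>Chosen so that \<open>q n * n \<ge> B\<close> makes the union bound term at most
    \<open>\<epsilon> / 2\<close>.\<close>
  define B where "B = 8 * 2 ^ K / (d\<^sup>2 * \<epsilon>)"
  have B: "B > 0" using d \<epsilon> by (simp add: B_def)
  have "eventually (\<lambda>n. real n \<ge> 2 / (d\<^sup>2 * \<epsilon>)) at_top"
    using filterlim_real_sequentially by (simp add: filterlim_at_top)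
  with weakly_pseudorandom_eventually[OF q G(2) d2 B] show ?thesis using eventually_gt_at_top[of 0]
  proof eventually_elim
    case (elim n)
    show ?case
    proof
      fix \<mu> assume \<mu>: "\<mu> \<in> M1p (prod_K2 n (G n)) p"
      have "measure_pmf.prob \<mu> {S. \<not> left_meets_right n S}
         \<le> 2 * (2 ^ K * (2 / (d\<^sup>2 * (q n * real n)))) + 1 / (d\<^sup>2 * real n)"
      proof (rule prob_not_left_meets_right_le[OF G(1) _ _ _ True d_def _ \<mu> K])
        show "crit\<^sup>2 < p" using p by (simp only: threshold_eq)
      qed (use elim in blast)+
      also have "2 * (2 ^ K * (2 / (d\<^sup>2 * (q n * real n)))) = 4 * 2 ^ K / d\<^sup>2 / (q n * real n)" by simp
      also have "\<dots> \<le> 4 * 2 ^ K / d\<^sup>2 / B" using elim B by (intro divide_left_mono) auto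
      also have "\<dots> = \<epsilon> / 2" using d \<epsilon> by (simp add: B_def field_simps)
      also have "1 / (d\<^sup>2 * real n) \<le> \<epsilon> / 2" using elim d \<epsilon> by (simp add: field_simps)
      finally have "measure_pmf.prob \<mu> {S. \<not> left_meets_right n S} \<le> \<epsilon>" by simp
      moreover have "{S. \<not> left_meets_right n S} = UNIV - {S. left_meets_right n S}" by auto
      ultimately show "1 - \<epsilon> \<le> measure_pmf.prob \<mu> {S. left_meets_right n S}"
        using measure_pmf.prob_compl[of "{S. left_meets_right n S}" \<mu>] by simp
    qed
  qed
next
  case False
  \<comment> \<open>No vertical edge can have probability \<open>p > 1\<close>, so the claim is
    vacuous once \<open>n > 0\<close>.\<close>
  have "M1p (prod_K2 n (G n)) p = {}" if "n > 0" for n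
  proof -
    have "{(1, 1), (2, 1)} \<in> prod_K2 n (G n)" using that by (auto simp: prod_K2_def)
    thus ?thesis using False measure_pmf.prob_le_1 unfolding M1p_def by fastforce
  qed
  thus ?thesis by (intro eventually_mono[OF eventually_gt_at_top[of 0]]) simp
qed

section \<open>The colouring model below the threshold\<close>

lemma prob_pair_pmf_times:
  "measure_pmf.prob (pair_pmf M N) {(a, b). Q a \<and> R b} = measure_pmf.prob M {a. Q a} * measure_pmf.prob N {b. R b}"
proof -
  have "emeasure (pair_pmf M N) {(a, b). Q a \<and> R b} = (\<integral>\<^sup>+z. indicator {(a, b). Q a \<and> R b} z \<partial>pair_pmf M N)"
    by simp
  also have "\<dots> = (\<integral>\<^sup>+a. \<integral>\<^sup>+b. indicator {a. Q a} a * indicator {b. R b} b \<partial>N \<partial>M)"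
    unfolding nn_integral_pair_pmf' by (intro nn_integral_cong) (auto simp: indicator_def)
  also have "\<dots> = emeasure M {a. Q a} * emeasure N {b. R b}"
    by (simp add: nn_integral_cmult nn_integral_multc)
  finally show ?thesis
    by (simp add: measure_pmf.emeasure_eq_measure ennreal_mult[symmetric])
qed

text \<open>Splitting off the coordinates in \<open>X\<close> presents the product measure as a pair
  of independent factors. \<open>Q\<close> reads only the first factor and, as \<open>Y\<close>
  avoids \<open>X\<close>, \<open>R\<close> reads only the second.\<close>

lemma prob_Pi_pmf_indep:
  assumes V: "finite V" and XY: "X \<subseteq> V" "Y \<subseteq> V" "X \<inter> Y = {}"
    and Q: "\<And>c c'. (\<And>x. x \<in> X \<Longrightarrow> c x = c' x) \<Longrightarrow> Q c = Q c'"
    and R: "\<And>c c'. (\<And>x. x \<in> Y \<Longrightarrow> c x = c' x) \<Longrightarrow> R c = R c'"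
  shows "measure_pmf.prob (Pi_pmf V d P) {c. Q c \<and> R c}
           = measure_pmf.prob (Pi_pmf V d P) {c. Q c} * measure_pmf.prob (Pi_pmf V d P) {c. R c}"
proof -
  define M where "M = Pi_pmf X d P"
  define N where "N = Pi_pmf (V - X) d P"
  have fin: "finite X" "finite (V - X)" using V XY finite_subset by auto
  have "V = X \<union> (V - X)" using XY by auto
  hence eq: "Pi_pmf V d P = map_pmf (\<lambda>(f, g) x. if x \<in> X then f x else g x) (pair_pmf M N)"
    using Pi_pmf_union[OF fin, of d P] unfolding M_def N_def by auto
  have Q': "Q (\<lambda>x. if x \<in> X then f x else g x) = Q f" for f g by (rule Q) simp
  have R': "R (\<lambda>x. if x \<in> X then f x else g x) = R g" for f g using XY by (intro R) auto
  have *: "measure_pmf.prob (Pi_pmf V d P) {c. S c} = measure_pmf.prob (pair_pmf M N) {(f, g). S (\<lambda>x. if x \<in> X then f x else g x)}"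
    for S unfolding eq by (simp add: vimage_def split_def)
  show ?thesis
    using prob_pair_pmf_times[of M N Q R] prob_pair_pmf_times[of M N Q "\<lambda>_. True"]
      prob_pair_pmf_times[of M N "\<lambda>_. True" R]
    unfolding * Q' R' by simp
qed

lemma prob_Pi_pmf_component:
  assumes "finite V" "x \<in> V"
  shows "measure_pmf.prob (Pi_pmf V d P) {c. Q (c x)} = measure_pmf.prob (P x) {b. Q b}"
  using assms Pi_pmf_component[OF assms(1), of x d P, symmetric] by (simp add: vimage_def)

text \<open>The source of 1-independence in the construction: the state of an edge depends only on
  the labels of its own ends, and labels of disjoint vertex sets are independent.\<close>

lemma one_independent_vertex_labels:
  assumes V: "finite V" "\<Union>H \<subseteq> V"
    and k: "\<And>c c' e. e \<in> H \<Longrightarrow> (\<And>x. x \<in> e \<Longrightarrow> c x = c' x) \<Longrightarrow> k c e = k c' e"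
  shows "one_independent H (map_pmf (\<lambda>c. {e\<in>H. k c e}) (Pi_pmf V d P))"
  unfolding one_independent_def
proof (intro allI impI, elim conjE)
  fix A B a b assume AB: "A \<subseteq> H" "B \<subseteq> H" "\<Union>A \<inter> \<Union>B = {}"
  have dep: "({e\<in>H. k c e} \<inter> A = a) = ({e\<in>H. k c' e} \<inter> A = a)"
    if "A \<subseteq> H" "\<And>x. x \<in> \<Union>A \<Longrightarrow> c x = c' x" for c c' A a
  proof -
    have "k c e = k c' e" if "e \<in> A" for e using that \<open>A \<subseteq> H\<close> that(1) \<open>\<And>x. x \<in> \<Union>A \<Longrightarrow> c x = c' x\<close>
      by (intro k) auto
    hence "{e\<in>H. k c e} \<inter> A = {e\<in>H. k c' e} \<inter> A" by auto
    thus ?thesis by simp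
  qed
  have "measure_pmf.prob (Pi_pmf V d P) {c. {e\<in>H. k c e} \<inter> A = a \<and> {e\<in>H. k c e} \<inter> B = b}
     = measure_pmf.prob (Pi_pmf V d P) {c. {e\<in>H. k c e} \<inter> A = a} * measure_pmf.prob (Pi_pmf V d P) {c. {e\<in>H. k c e} \<inter> B = b}"
  proof (rule prob_Pi_pmf_indep[OF V(1) _ _ AB(3)])
    show "\<Union>A \<subseteq> V" "\<Union>B \<subseteq> V" using AB(1,2) V(2) by blast+
  qed (fact dep[OF AB(1)] dep[OF AB(2)])+
  thus "measure_pmf.prob (map_pmf (\<lambda>c. {e\<in>H. k c e}) (Pi_pmf V d P)) {S. S \<inter> A = a \<and> S \<inter> B = b} =
       measure_pmf.prob (map_pmf (\<lambda>c. {e\<in>H. k c e}) (Pi_pmf V d P)) {S. S \<inter> A = a} *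
       measure_pmf.prob (map_pmf (\<lambda>c. {e\<in>H. k c e}) (Pi_pmf V d P)) {S. S \<inter> B = b}"
    by (simp add: vimage_def)
qed

text \<open>\<open>True\<close> means red on the left and on on the right. The image of
  \<open>e\<close> under \<open>fst\<close> tells left, right and vertical edges apart without
  choosing an orientation of \<open>e\<close>.\<close>

definition kept :: "(nat \<times> nat \<Rightarrow> bool) \<Rightarrow> (nat \<times> nat) set \<Rightarrow> bool" where
  "kept c e = (if fst ` e = {1} then (\<forall>x\<in>e. c x) \<or> (\<forall>x\<in>e. \<not> c x)
               else if fst ` e = {2} then \<forall>x\<in>e. c x
               else \<not> (\<forall>x\<in>e. c x))"

definition colouring :: "real \<Rightarrow> real \<Rightarrow> nat \<Rightarrow> (nat \<times> nat \<Rightarrow> bool) pmf" where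
  "colouring a b n = Pi_pmf ({1, 2} \<times> {1..n}) False (\<lambda>x. bernoulli_pmf (if fst x = 1 then a else b))"

definition kept_edges :: "(nat \<times> nat) set set \<Rightarrow> (nat \<times> nat \<Rightarrow> bool) \<Rightarrow> (nat \<times> nat) set set" where
  "kept_edges H c = {e \<in> H. kept c e}"

lemma prod_K2_cases:
  assumes "graph_on n E" "e \<in> prod_K2 n E"
  obtains (side) i u v where "i \<in> {1, 2}" "u \<in> {1..n}" "v \<in> {1..n}" "u \<noteq> v" "{u, v} \<in> E" "e = {(i, u), (i, v)}"
    | (rung) v where "v \<in> {1..n}" "e = {(1, v), (2, v)}"
proof -
  from assms(2) consider (1) i u v where "i \<in> {1, 2}" "{u, v} \<in> E" "e = {(i, u), (i, v)}"
    | (2) v where "v \<in> {1..n}" "e = {(1, v), (2, v)}"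
    unfolding prod_K2_def by blast
  thus thesis
  proof cases
    case 1
    moreover have "{u, v} \<subseteq> {1..n}" "card {u, v} = 2"
      using graph_onD(3,4)[OF assms(1) 1(2)] by auto
    ultimately show ?thesis using side[of i u v] by (cases "u = v") auto
  qed (rule rung)
qed

lemma colouring_single:
  assumes "x \<in> {1, 2} \<times> {1..n}" "0 \<le> a" "a \<le> 1" "0 \<le> b" "b \<le> 1"
  shows "measure_pmf.prob (colouring a b n) {c. c x} = (if fst x = 1 then a else b)"
    and "measure_pmf.prob (colouring a b n) {c. \<not> c x} = 1 - (if fst x = 1 then a else b)"
proof -
  let ?V = "{1, 2} \<times> {1..n} :: (nat \<times> nat) set"
  have fin: "finite ?V" by simp
  have T: "{b. b} = {True}" "{b. \<not> b} = {False}" by auto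
  show "measure_pmf.prob (colouring a b n) {c. c x} = (if fst x = 1 then a else b)"
    using prob_Pi_pmf_component[OF fin assms(1), of _ _ "\<lambda>b. b"] assms
    unfolding colouring_def T by (simp add: measure_pmf_single)
  show "measure_pmf.prob (colouring a b n) {c. \<not> c x} = 1 - (if fst x = 1 then a else b)"
    using prob_Pi_pmf_component[OF fin assms(1), of _ _ "\<lambda>b. \<not> b"] assms
    unfolding colouring_def T by (simp add: measure_pmf_single)
qed

lemma colouring_pair:
  assumes "x \<in> {1, 2} \<times> {1..n}" "y \<in> {1, 2} \<times> {1..n}" "x \<noteq> y"
  shows "measure_pmf.prob (colouring a b n) {c. Q (c x) \<and> R (c y)}
    = measure_pmf.prob (colouring a b n) {c. Q (c x)} * measure_pmf.prob (colouring a b n) {c. R (c y)}"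
  unfolding colouring_def by (rule prob_Pi_pmf_indep[where X = "{x}" and Y = "{y}"]) (use assms in auto)

text \<open>The three bounds on \<open>p\<close> refer to the probabilities of a monochromatic left
  edge, of a right edge with both ends on, and of a vertical edge that does not join red to
  on.\<close>

lemma colouring_in_M1gep:
  assumes G: "graph_on n E" and ab: "0 \<le> a" "a \<le> 1" "0 \<le> b" "b \<le> 1"
    and p: "p \<le> a\<^sup>2 + (1 - a)\<^sup>2" "p \<le> b\<^sup>2" "p \<le> 1 - a * b"
  shows "map_pmf (kept_edges (prod_K2 n E)) (colouring a b n) \<in> M1gep (prod_K2 n E) p"
proof -
  let ?H = "prod_K2 n E" and ?M = "colouring a b n"
  have sub: "\<Union>?H \<subseteq> {1, 2} \<times> {1..n}"
    by (auto elim!: prod_K2_cases[OF G])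
  have "one_independent ?H (map_pmf (kept_edges ?H) ?M)"
    unfolding kept_edges_def[abs_def] colouring_def
    by (rule one_independent_vertex_labels[OF _ sub]) (auto simp: kept_def)
  moreover have "p \<le> measure_pmf.prob (map_pmf (kept_edges ?H) ?M) {S. e \<in> S}" if e: "e \<in> ?H" for e
  proof -
    have eq: "measure_pmf.prob (map_pmf (kept_edges ?H) ?M) {S. e \<in> S} = measure_pmf.prob ?M {c. kept c e}"
      using e by (simp add: vimage_def kept_edges_def)
    from G e show ?thesis
    proof (cases rule: prod_K2_cases)
      case (side i u v)
      have xy: "(i, u) \<in> {1, 2} \<times> {1..n}" "(i, v) \<in> {1, 2} \<times> {1..n}" "(i, u) \<noteq> (i, v)" using side by auto
      note single = colouring_single[OF xy(1) ab] colouring_single[OF xy(2) ab]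
      show ?thesis
      proof (cases "i = 1")
        case True
        have "{c. kept c e} = {c. c (i, u) \<and> c (i, v)} \<union> {c. \<not> c (i, u) \<and> \<not> c (i, v)}"
          using side True by (auto simp: kept_def)
        hence "measure_pmf.prob ?M {c. kept c e} = measure_pmf.prob ?M {c. c (i, u) \<and> c (i, v)}
            + measure_pmf.prob ?M {c. \<not> c (i, u) \<and> \<not> c (i, v)}"
          by (simp only:) (intro measure_pmf.finite_measure_Union, auto)
        also have "\<dots> = a * a + (1 - a) * (1 - a)"
          using colouring_pair[OF xy, of _ _ "\<lambda>b. b" "\<lambda>b. b"] colouring_pair[OF xy, of _ _ Not Not] single True
          by simp
        finally show ?thesis using p(1) unfolding eq by (simp add: power2_eq_square)
      next
        case False
        hence "{c. kept c e} = {c. c (i, u) \<and> c (i, v)}"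
          using side by (auto simp: kept_def)
        thus ?thesis using colouring_pair[OF xy, of _ _ "\<lambda>b. b" "\<lambda>b. b"] single False p(2)
          unfolding eq by (simp add: power2_eq_square)
      qed
    next
      case (rung v)
      have xy: "(1, v) \<in> {1, 2} \<times> {1..n}" "(2, v) \<in> {1, 2} \<times> {1..n}" "(1::nat, v) \<noteq> (2, v)" using rung by auto
      have "{c. kept c e} = UNIV - {c. c (1, v) \<and> c (2, v)}"
        using rung by (auto simp: kept_def)
      hence "measure_pmf.prob ?M {c. kept c e} = 1 - measure_pmf.prob ?M {c. c (1, v) \<and> c (2, v)}"
        using measure_pmf.prob_compl[of "{c. c (1, v) \<and> c (2, v)}" ?M] by simp
      thus ?thesis using colouring_pair[OF xy, of _ _ "\<lambda>b. b" "\<lambda>b. b"] 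
          colouring_single[OF xy(1) ab] colouring_single[OF xy(2) ab] p(3)
        unfolding eq by simp
    qed
  qed
  ultimately show ?thesis unfolding M1gep_def by (auto simp: kept_edges_def)
qed

text \<open>The left colouring extends to the right so that every kept edge joins vertices of equal
  colour: on vertices become blue, and off vertices copy their partners. Components are therefore
  monochromatic.\<close>

lemma colouring_meets_imp_minority:
  assumes G: "graph_on n E" and meet: "left_meets_right n (kept_edges (prod_K2 n E) c)"
  shows "2 * card {v \<in> {1..n}. c (1, v)} \<le> n \<or> 2 * card {v \<in> {1..n}. c (2, v)} \<le> n"
proof -
  define S where "S = kept_edges (prod_K2 n E) c"
  \<comment> \<open>an off vertex has no right edges, so it can take the colour of its partner\<close>
  define col where "col x = (if fst x = 1 then c x else \<not> c x \<and> c (1, snd x))" for x :: "nat \<times> nat"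
  obtain x where x: "n < 2 * card (component S x \<inter> ({1} \<times> {1..n}))" "n < 2 * card (component S x \<inter> ({2} \<times> {1..n}))"
    using meet unfolding left_meets_right_def S_def by blast
  have "component S x \<subseteq> {y. col y = col x}"
  proof (rule component_closed)
    fix y z assume yz: "{y, z} \<in> S" "y \<in> {y. col y = col x}"
    hence "{y, z} \<in> prod_K2 n E" and k: "kept c {y, z}" by (auto simp: S_def kept_edges_def)
    from G this(1) have "col y = col z"
    proof (cases rule: prod_K2_cases)
      case (side i u v)
      have "fst y = i" "fst z = i" using side(6) by (auto simp: doubleton_eq_iff)
      thus ?thesis using k side(1) by (auto simp: kept_def col_def)
    next
      case (rung v)
      hence "y = (1, v) \<and> z = (2, v) \<or> y = (2, v) \<and> z = (1, v)" by (auto simp: doubleton_eq_iff)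
      thus ?thesis using k by (auto simp: kept_def col_def)
    qed
    thus "z \<in> {y. col y = col x}" using yz(2) by simp
  qed simp
  hence comp: "col y = col x" if "y \<in> component S x" for y using that by blast
  \<comment> \<open>On side \<open>i\<close> the component consists of minority candidates only: a
    red component meets the right in off vertices, a blue one meets the left in blue
    vertices.\<close>
  define i :: nat where "i = (if col x then 2 else 1)"
  have "component S x \<inter> ({i} \<times> {1..n}) \<subseteq> Pair i ` ({1..n} - {v \<in> {1..n}. c (i, v)})"
  proof
    fix y assume y: "y \<in> component S x \<inter> ({i} \<times> {1..n})"
    then obtain v where v: "y = (i, v)" "v \<in> {1..n}" by auto
    have "col (i, v) = col x" using comp y v by blast
    hence "\<not> c (i, v)" by (cases "col x") (auto simp: i_def col_def)
    thus "y \<in> Pair i ` ({1..n} - {v \<in> {1..n}. c (i, v)})" using v by blast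
  qed
  hence "card (component S x \<inter> ({i} \<times> {1..n})) \<le> card (Pair i ` ({1..n} - {v \<in> {1..n}. c (i, v)}))"
    by (intro card_mono) auto
  also have "\<dots> = n - card {v \<in> {1..n}. c (i, v)}"
  proof -
    have "{v \<in> {1..n}. c (i, v)} \<subseteq> {1..n}" by blast
    thus ?thesis by (simp add: card_image inj_on_def card_Diff_subset del: atLeastAtMost_iff)
  qed
  finally have "n < 2 * (n - card {v \<in> {1..n}. c (i, v)})"
    using x by (auto simp: i_def split: if_splits)
  thus ?thesis by (auto simp: i_def split: if_splits)
qed

text \<open>Since \<open>a\<close> and \<open>b\<close> exceed 1/2 by at least \<open>t\<close>,
  Chebyshev's inequality makes red and on vertices strict majorities of their sides with high
  probability.\<close>

lemma prob_colouring_meets_le: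
  assumes G: "graph_on n E" and ab: "1 / 2 + t \<le> a" "a \<le> 1" "1 / 2 + t \<le> b" "b \<le> 1" and "t > 0" "n > 0"
  shows "measure_pmf.prob (map_pmf (kept_edges (prod_K2 n E)) (colouring a b n)) {S. left_meets_right n S}
    \<le> 2 / t\<^sup>2 / real n"
proof -
  let ?M = "colouring a b n"
  have ab': "0 \<le> a" "a \<le> 1" "0 \<le> b" "b \<le> 1" using assms by auto
  define s where "s i = (if i = (1::nat) then a else b)" for i
  have dev: "measure_pmf.prob ?M {c. 2 * card {v \<in> {1..n}. c (i, v)} \<le> n} \<le> 1 / t\<^sup>2 / real n" if i: "i \<in> {1, 2}" for i
  proof -
    have "measure_pmf.prob ?M {c. 2 * card {v \<in> {1..n}. c (i, v)} \<le> n}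
       \<le> measure_pmf.prob ?M {c. real (card {v \<in> {1..n}. c (i, v)}) \<le> s i * real (card {1..n}) - t * real n}"
    proof (intro measure_pmf.finite_measure_mono subsetI)
      fix c assume "c \<in> {c. 2 * card {v \<in> {1..n}. c (i, v)} \<le> n}"
      hence "real (card {v \<in> {1..n}. c (i, v)}) \<le> 1 / 2 * real n" by simp
      also have "\<dots> \<le> (s i - t) * real n" using ab i by (intro mult_right_mono) (auto simp: s_def)
      finally show "c \<in> {c. real (card {v \<in> {1..n}. c (i, v)}) \<le> s i * real (card {1..n}) - t * real n}"
        by (simp add: algebra_simps)
    qed simp
    also have "\<dots> \<le> real (card ((\<lambda>v. (v, v)) ` {1..n})) / (t * real n)\<^sup>2"
    proof (rule prob_count_le)
      fix e assume e: "e \<in> {1..n}"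
      show single: "measure_pmf.prob ?M {c. c (i, e)} = s i"
        using colouring_single(1)[of "(i, e)", OF _ ab'] i e by (auto simp: s_def)
      fix f assume f: "f \<in> {1..n}" "(e, f) \<notin> (\<lambda>v. (v, v)) ` {1..n}"
      hence "e \<noteq> f" using e by auto
      thus "measure_pmf.prob ?M {c. c (i, e) \<and> c (i, f)} = s i * s i"
        using colouring_pair[of "(i, e)" n "(i, f)" a b "\<lambda>b. b" "\<lambda>b. b"] i e f
          colouring_single(1)[of "(i, e)", OF _ ab'] colouring_single(1)[of "(i, f)", OF _ ab']
        by (auto simp: s_def)
    qed (use assms in auto)
    also have "card ((\<lambda>v. (v, v)) ` {1..n}) = n" by (subst card_image) (auto simp: inj_on_def)
    also have "real n / (t * real n)\<^sup>2 = 1 / t\<^sup>2 / real n"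
      using \<open>n > 0\<close> by (simp add: power2_eq_square)
    finally show ?thesis .
  qed
  have "measure_pmf.prob (map_pmf (kept_edges (prod_K2 n E)) ?M) {S. left_meets_right n S}
     = measure_pmf.prob ?M {c. left_meets_right n (kept_edges (prod_K2 n E) c)}"
    by (simp add: vimage_def)
  also have "\<dots> \<le> measure_pmf.prob ?M ({c. 2 * card {v \<in> {1..n}. c (1, v)} \<le> n} \<union> {c. 2 * card {v \<in> {1..n}. c (2, v)} \<le> n})"
    using colouring_meets_imp_minority[OF G] by (intro measure_pmf.finite_measure_mono) auto
  also have "\<dots> \<le> measure_pmf.prob ?M {c. 2 * card {v \<in> {1..n}. c (1, v)} \<le> n}
     + measure_pmf.prob ?M {c. 2 * card {v \<in> {1..n}. c (2, v)} \<le> n}"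
    by (rule measure_Un_le) auto
  also have "\<dots> \<le> 1 / t\<^sup>2 / real n + 1 / t\<^sup>2 / real n" by (intro add_mono dev) auto
  finally show ?thesis by (simp add: mult.commute)
qed

lemma exists_model_not_meeting:
  fixes p :: real
  assumes G: "\<And>n. graph_on n (G n)" and p: "1 / 2 < p" "p \<le> 4 - 2 * sqrt 3"
  shows "\<exists>\<mu>. (\<forall>n. \<mu> n \<in> M1gep (prod_K2 n (G n)) p) \<and>
                 (\<lambda>n. measure_pmf.prob (\<mu> n) {S. left_meets_right n S}) \<longlonglongrightarrow> 0"
proof -
  \<comment> \<open>\<open>a\<close> is the larger root of
    \<open>a\<^sup>2 + (1 - a)\<^sup>2 = p\<close> and \<open>b\<close> solves
    \<open>b\<^sup>2 = p\<close>, so the left and right edges have probability exactly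
    \<open>p\<close>.\<close>
  define a where "a = (1 + sqrt (2 * p - 1)) / 2"
  define b where "b = sqrt p"
  have p1: "p \<le> 1" using p(2) real_le_rsqrt[of "3 / 2" 3] by (simp add: power2_eq_square)
  have a: "1 / 2 < a" "a \<le> 1" using p p1 by (auto simp: a_def)
  have b: "1 / 2 < b" "b \<le> 1" using p p1 real_less_rsqrt[of "1 / 2" p] by (auto simp: b_def power2_eq_square)
  have b2: "b\<^sup>2 = p" using p by (simp add: b_def)
  have "sqrt (2 * p - 1) ^ 2 = 2 * p - 1" using p by simp
  moreover have "a\<^sup>2 + (1 - a)\<^sup>2 = (1 + sqrt (2 * p - 1) ^ 2) / 2"
    by (simp add: a_def power2_eq_square field_simps)
  ultimately have a2: "a\<^sup>2 + (1 - a)\<^sup>2 = p" by simp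
  \<comment> \<open>Both \<open>a\<close> and \<open>b\<close> grow with \<open>p\<close>, so they
    are bounded by their values at the threshold, where \<open>a * b = 1 - p\<close> holds with
    equality.\<close>
  have "b \<le> sqrt 3 - 1"
    unfolding b_def using p(2) by (intro real_le_lsqrt) (auto simp: power2_eq_square algebra_simps)
  moreover have "sqrt (2 * p - 1) \<le> 2 - sqrt 3"
    using p(2) by (intro real_le_lsqrt) (auto simp: power2_eq_square algebra_simps intro: real_le_lsqrt)
  hence "a \<le> (3 - sqrt 3) / 2" by (simp add: a_def)
  ultimately have "a * b \<le> (3 - sqrt 3) / 2 * (sqrt 3 - 1)" using a b by (intro mult_mono) auto
  also have "\<dots> = 1 - (4 - 2 * sqrt 3)" by (simp add: field_simps)
  finally have ab: "p \<le> 1 - a * b" using p(2) by linarith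
  define \<mu> where "\<mu> n = map_pmf (kept_edges (prod_K2 n (G n))) (colouring a b n)" for n
  have "\<mu> n \<in> M1gep (prod_K2 n (G n)) p" for n
    unfolding \<mu>_def using a b a2 b2 ab by (intro colouring_in_M1gep G) auto
  moreover have "(\<lambda>n. measure_pmf.prob (\<mu> n) {S. left_meets_right n S}) \<longlonglongrightarrow> 0"
  proof (rule tendsto_sandwich[where f = "\<lambda>_. 0"])
    define t where "t = min a b - 1 / 2"
    have t: "t > 0" "1 / 2 + t \<le> a" "1 / 2 + t \<le> b" using a b by (auto simp: t_def)
    show "\<forall>\<^sub>F n in sequentially. measure_pmf.prob (\<mu> n) {S. left_meets_right n S} \<le> 2 / t\<^sup>2 / real n"
      using eventually_gt_at_top[of 0] unfolding \<mu>_def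
      by eventually_elim (use a b t in \<open>intro prob_colouring_meets_le G\<close>, auto)
    show "(\<lambda>n. 2 / t\<^sup>2 / real n) \<longlonglongrightarrow> 0"
      using tendsto_mult_right_zero[OF lim_1_over_n, of "2 / t\<^sup>2"] by simp
  qed auto
  ultimately show ?thesis by blast
qed

theorem theorem19:
  fixes q :: "nat \<Rightarrow> real" and G :: "nat \<Rightarrow> nat set set"
  assumes "(\<lambda>n. ln (real n)) \<in> o[at_top](\<lambda>n. q n * real n)"
    and "\<forall>n. graph_on n (G n)"
    and "weakly_pseudorandom q G"
  shows "(\<forall>p::real. 4 - 2 * sqrt 3 < p \<longrightarrow>
            (\<forall>\<epsilon>>0. eventually (\<lambda>n. \<forall>\<mu>\<in>M1p (prod_K2 n (G n)) p.
                 measure_pmf.prob \<mu> {S. left_meets_right n S} \<ge> 1 - \<epsilon>) at_top))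
       \<and> (\<forall>p::real. 1/2 < p \<and> p \<le> 4 - 2 * sqrt 3 \<longrightarrow>
            (\<exists>\<mu>. (\<forall>n. \<mu> n \<in> M1gep (prod_K2 n (G n)) p) \<and>
                 (\<lambda>n. measure_pmf.prob (\<mu> n) {S. left_meets_right n S}) \<longlonglongrightarrow> 0))"
proof (intro conjI allI impI)
  fix p \<epsilon> :: real
  assume "4 - 2 * sqrt 3 < p" "\<epsilon> > 0"
  with assms show "eventually (\<lambda>n. \<forall>\<mu>\<in>M1p (prod_K2 n (G n)) p.
      measure_pmf.prob \<mu> {S. left_meets_right n S} \<ge> 1 - \<epsilon>) at_top"
    by (intro eventually_left_meets_right) auto
next
  fix p :: real
  assume "1 / 2 < p \<and> p \<le> 4 - 2 * sqrt 3"
  with assms(2) show "\<exists>\<mu>. (\<forall>n. \<mu> n \<in> M1gep (prod_K2 n (G n)) p) \<and>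
      (\<lambda>n. measure_pmf.prob (\<mu> n) {S. left_meets_right n S}) \<longlonglongrightarrow> 0"
    by (intro exists_model_not_meeting) auto
qed

end
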